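(* Let $n\ge 4$ and let $\mathcal{L}(f)=\int_{\Omega}f(\mathbf{X})\rho(\mathbf{X})\,d\mathbf{X}$ be a spherically symmetric integral functional on $\mathbb{R}^n$ with finite polynomial moments of degree at most $5$, normalized so that $\mathcal{L}(1)=1$. Put $$V=\frac{2\pi^{n/2}}{\Gamma(n/2)},\qquad \gamma=\frac{(\mathcal{L}(x_1^2))^2}{\mathcal{L}(x_1^2x_2^2)}\cdot\frac{2\,\Gamma(n/2+2)}{\pi^{n/2}(n+2)^2},\qquad \tau=\left(\frac{\mathcal{L}(x_1^2x_2^2)}{\gamma\,\mathcal{L}_1(x_1^2x_2^2)}\right)^{1/4},$$ $$\tilde A=\gamma\,\frac{n(7-n)V}{2(n+1)^2(n+2)},\qquad \tilde B=\gamma\,\frac{2(n-1)^2V}{n(n+1)^2(n+2)}.$$ Then $$C_n(f)=\tilde A\sum_{j=1}^{n+1}\big[f(\tau\mathbf{a}^{(j)})+f(-\tau\mathbf{a}^{(j)})\big]+\tilde B\sum_{j=1}^{n(n+1)/2}\big[f(\tau\mathbf{b}^{(j)})+f(-\tau\mathbf{b}^{(j)})\big]+(1-\gamma V)\,f(0,\dots,0)$$ is a cubature formula of degree five for $\mathcal{L}$, with at most $n^2+3n+3$ points. Moreover, if $n=7$ then $\tilde A=0$ and $C_n$ is a minimal cubature formula of degree five for $\mathcal{L}$, containing only $n^2+n+1$ points.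
   Context: $\mathcal{L}$ is a spherically symmetric integral functional if the region is of the form $\Omega=\{\mathbf{X}\in\mathbb{R}^n : p\le \|\mathbf{X}\|<q\}$ with $0\le p<q\le\infty$, and the weight function $\rho\ge 0$ is a function of the Euclidean norm $\|\mathbf{X}\|=\sqrt{x_1^2+\dots+x_n^2}$ only. $\mathcal{L}_1(f)=\int_{U_n}f\,d\mathbf{X}$ denotes surface integration over the unit sphere $U_n=\{\mathbf{X}\in\mathbb{R}^n:x_1^2+\dots+x_n^2=1\}$; $V=\mathcal{L}_1(1)$ and $\mathcal{L}_1(x_1^2x_2^2)=\dfrac{\pi^{n/2}}{2\,\Gamma(n/2+2)}$. For $r=1,\dots,n+1$ the vector $\mathbf{a}^{(r)}=(a_1^{(r)},\dots,a_n^{(r)})\in\mathbb{R}^n$ is given by $$a_i^{(r)}=\begin{cases}-\sqrt{\dfrac{n+1}{n(n-i+2)(n-i+1)}}, & i<r,\\[2mm] \sqrt{\dfrac{(n+1)(n-r+1)}{n(n-r+2)}}, & i=r,\\[2mm] 0,& i>r.\end{cases}$$ The vectors $\mathbf{b}^{(j)}$, $1\le j\le n(n+1)/2$, enumerate the family $\sqrt{\dfrac{n}{2(n-1)}}\,(\mathbf{a}^{(k)}+\mathbf{a}^{(l)})$, $1\le k<l\le n+1$. A cubature formula for $\mathcal{L}$ with $N$ points is a functional $C(f)=\sum_{j=1}^N w_jf(\mathbf{x}^{(j)})$ with real weights $w_j$ and points $\mathbf{x}^{(j)}\in\mathbb{R}^n$ (not required to lie in $\Omega$); it is of degree five if $C(f)=\mathcal{L}(f)$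 for every real polynomial $f$ of total degree at most $5$. It is minimal if no cubature formula of degree five for $\mathcal{L}$ uses fewer points. *)

theory Defs
  imports "HOL-Analysis.Analysis"
begin

definition monomial_fun :: "('n::finite \<Rightarrow> nat) \<Rightarrow> real ^ 'n \<Rightarrow> real" where
  "monomial_fun \<alpha> x = (\<Prod>i\<in>UNIV. (x $ i) ^ \<alpha> i)"

text \<open>The index set of the sum is finite because the type of indices is.\<close>

definition poly_funs :: "nat \<Rightarrow> (real ^ 'n::finite \<Rightarrow> real) set" where
  "poly_funs d = {f. \<exists>c. f = (\<lambda>x. \<Sum>\<alpha> | sum \<alpha> UNIV \<le> d. c \<alpha> * monomial_fun \<alpha> x)}"

definition cubature_formula :: "nat \<Rightarrow> ((real ^ 'n \<Rightarrow> real) \<Rightarrow> real) \<Rightarrow> bool" where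
  "cubature_formula N C \<longleftrightarrow>
     (\<exists>w :: nat \<Rightarrow> real. \<exists>x :: nat \<Rightarrow> real ^ 'n. \<forall>f. C f = (\<Sum>j = 1..N. w j * f (x j)))"

definition cubature_of_degree ::
  "((real ^ 'n::finite \<Rightarrow> real) \<Rightarrow> real) \<Rightarrow> nat \<Rightarrow> nat \<Rightarrow> ((real ^ 'n \<Rightarrow> real) \<Rightarrow> real) \<Rightarrow> bool" where
  "cubature_of_degree L d N C \<longleftrightarrow> cubature_formula N C \<and> (\<forall>f\<in>poly_funs d. C f = L f)"

text \<open>
  Points may be repeated and weights may vanish in a representation with \<open>N\<close> points. A minimal
  formula admits no such redundancy, since removing it would leave a formula with fewer points.
\<close>

definition minimal_cubature_of_degree ::
  "((real ^ 'n::finite \<Rightarrow> real) \<Rightarrow> real) \<Rightarrow> nat \<Rightarrow> nat \<Rightarrow> ((real ^ 'n \<Rightarrow> real) \<Rightarrow> real) \<Rightarrow> bool" where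
  "minimal_cubature_of_degree L d N C \<longleftrightarrow>
     cubature_of_degree L d N C \<and> (\<forall>N' C'. cubature_of_degree L d N' C' \<longrightarrow> N \<le> N')"

definition shell :: "real \<Rightarrow> ereal \<Rightarrow> 'a::euclidean_space set" where
  "shell p q = {x. p \<le> norm x \<and> ereal (norm x) < q}"

definition weighted_integral :: "'a::euclidean_space set \<Rightarrow> ('a \<Rightarrow> real) \<Rightarrow> ('a \<Rightarrow> real) \<Rightarrow> real" where
  "weighted_integral \<Omega> \<rho> f = (LINT x:\<Omega>|lebesgue. f x * \<rho> x)"

text \<open>
  Surface measure of the unit sphere of an \<open>n\<close>-dimensional space, as it arises from polar
  coordinates: the area of a set \<open>E\<close> of unit vectors is \<open>n\<close> times the volume of the cone
  \<open>{t \<theta> | 0 < t < 1, \<theta> \<in> E}\<close>. Here \<open>sgn x = x / norm x\<close>; the value \<open>sgn 0 = 0\<close> only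
  concerns a null set.
\<close>

definition sphere_measure :: "'a::euclidean_space measure" where
  "sphere_measure =
     scale_measure (of_nat DIM('a)) (distr (restrict_space lborel (ball 0 1)) borel sgn)"

definition sphere_integral :: "('a::euclidean_space \<Rightarrow> real) \<Rightarrow> real" where
  "sphere_integral f = (LINT x|sphere_measure. f x)"

text \<open>
  The index type carries no order, so an enumeration \<open>e 1, \<dots>, e n\<close> of it determines which
  coordinate of \<open>x\<close> is called \<open>x\<^sub>i\<close>, namely \<open>x $ e i\<close>.
\<close>

definition a_coord :: "nat \<Rightarrow> nat \<Rightarrow> nat \<Rightarrow> real" where
  "a_coord n r i =
     (if i < r then
        - sqrt ((real n + 1) / (real n * (real n - real i + 2) * (real n - real i + 1)))
      else if i = r then
        sqrt ((real n + 1) * (real n - real r + 1) / (real n * (real n - real r + 2)))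
      else 0)"

definition a_vec :: "(nat \<Rightarrow> 'n::finite) \<Rightarrow> nat \<Rightarrow> real ^ 'n" where
  "a_vec e r = (\<chi> k. a_coord CARD('n) r (the_inv_into {1..CARD('n)} e k))"

definition b_vec :: "(nat \<Rightarrow> 'n::finite) \<Rightarrow> nat \<Rightarrow> nat \<Rightarrow> real ^ 'n" where
  "b_vec e k l =
     sqrt (real CARD('n) / (2 * (real CARD('n) - 1))) *\<^sub>R (a_vec e k + a_vec e l)"

end

theory Submission
  imports Defs
begin

text \<open>
  Lebesgue measure is invariant under orthogonal maps (\<open>lborel_distr_orthogonal\<close>), so a spherically
  symmetric functional vanishes on odd polynomials, and its moments of degree two and four are
  \<open>s \<delta>\<^sub>i\<^sub>j\<close> and \<open>t (\<delta>\<^sub>i\<^sub>j \<delta>\<^sub>k\<^sub>l + \<delta>\<^sub>i\<^sub>k \<delta>\<^sub>j\<^sub>l + \<delta>\<^sub>i\<^sub>l \<delta>\<^sub>j\<^sub>k)\<close>, with two numbers \<open>s, t > 0\<close>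
  (\<open>spherical_moments_radial\<close>). The fourth moments of the unit sphere have the same form. As they sum
  up to the surface area \<open>V\<close>, the integral of \<open>x\<^sub>1\<^sup>2 x\<^sub>2\<^sup>2\<close> over the sphere is \<open>V / (n (n + 2))\<close>
  (\<open>sphere_integral_fourth\<close>).

  Degree five. The formula is centrally symmetric, so its odd moments vanish too. The vectors
  \<open>a_vec e r\<close> are the vertices of a regular simplex: each coordinate sums to zero over the vertices, and
  different coordinates are orthogonal (\<open>sum_a_vec\<close>, \<open>sum_a_vec_mult\<close>). By a multilinear expansion
  (\<open>sum_pairs_fourth\<close>) the fourth moments of the edge midpoints are a multiple of the isotropic tensor
  above plus a multiple of \<open>n - 7\<close> times the fourth moments of the vertices, and the ratio of the two
  weights is chosen to cancel the latter. It remains to match one number in each of the degrees zero,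
  two and four, which determines the weight of the origin, \<open>\<gamma>\<close> and \<open>\<tau>\<close> (\<open>simplex_rule_one\<close>,
  \<open>simplex_rule_second\<close>, \<open>simplex_rule_fourth\<close>). Since polynomials are sums of monomials, agreement of
  these moments suffices (\<open>eq_on_poly_funs_5I\<close>).

  Minimality. For \<open>n = 7\<close> the weight of the vertices is zero, and the remaining number of points
  \<open>n\<^sup>2 + n + 1\<close> is Moeller's lower bound \<open>2 m - 1\<close>, where \<open>m = n (n + 1) / 2 + 1\<close> is the
  dimension of the space of even polynomials of degree at most two. The bound
  (\<open>cubature_degree_five_lower_bound\<close>) rests on an isotropy argument (\<open>isotropic_dim_bound\<close>) and on
  the nondegeneracy of the functional on this space (\<open>nondegenerate\<close>), which in turn reduces to
  \<open>n s\<^sup>2 < (n + 2) t\<close>, the strict Cauchy-Schwarz inequality for \<open>1\<close> and \<open>\<parallel>x\<parallel>\<^sup>2\<close>.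
\<close>

section \<open>Invariance of Lebesgue measure under orthogonal maps\<close>

text \<open>
  Up to a null set, an open set is a countable disjoint union of balls, and an orthogonal map
  carries these to disjoint balls of the same radii inside the image. Since only \<open>\<le>\<close> is claimed,
  nothing has to be known about the image of the null set; the converse inequality comes from
  applying this one to the inverse map.
\<close>

lemma emeasure_orthogonal_image_open_ge:
  fixes T :: "'a::euclidean_space \<Rightarrow> 'a"
  assumes T: "orthogonal_transformation T" and S: "open S" and TS: "T ` S \<in> sets lborel"
  shows "emeasure lborel S \<le> emeasure lborel (T ` S)"
proof -
  define K where "K = {(x, r). 0 < r \<and> ball x r \<subseteq> S}"
  have "\<exists>i. i \<in> K \<and> x \<in> ball (fst i) (snd i) \<and> snd i < d" if x: "x \<in> S" and d: "0 < d" for x d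
  proof -
    obtain r where r: "0 < r" "ball x r \<subseteq> S"
      using S x open_contains_ball by blast
    let ?r = "min r (d / 2)"
    have "ball x ?r \<subseteq> S" using r(2) subset_ball[of ?r r x] by simp
    then show ?thesis
      using r(1) d by (intro exI[of _ "(x, ?r)"]) (auto simp: K_def)
  qed
  then obtain C where C: "countable C" "C \<subseteq> K"
    and disj: "pairwise (\<lambda>i j. disjnt (ball (fst i) (snd i)) (ball (fst j) (snd j))) C"
    and negl: "negligible (S - (\<Union>i\<in>C. ball (fst i) (snd i)))"
    by (rule Vitali_covering_theorem_balls[where a = fst and r = snd and S = S and K = K]) blast
  let ?B = "\<lambda>i. ball (fst i) (snd i) :: 'a set"
  let ?U = "\<Union>i\<in>C. ?B i"
  have US: "?U \<subseteq> S" using C(2) unfolding K_def by fastforce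
  have U: "?U \<in> sets lborel" by (simp, intro borel_open open_UN) auto
  have ball_eq: "emeasure lborel (T ` ?B i) = emeasure lborel (?B i)" if "i \<in> C" for i
    using that C(2) unfolding image_orthogonal_transformation_ball[OF T]
    by (auto simp: K_def emeasure_ball)
  have inj: "inj T" using T by (rule orthogonal_transformation_inj)
  have d1: "disjoint_family_on ?B C" and d2: "disjoint_family_on (\<lambda>i. T ` ?B i) C"
    using disj inj by (auto simp: disjoint_family_on_def pairwise_def disjnt_def
        image_Int[symmetric])
  have "emeasure lborel S = emeasure lborel (?U \<union> (S - ?U))"
    using US by (simp add: Un_absorb1)
  also have "\<dots> = emeasure lborel ?U"
  proof (rule emeasure_Un_null_set[OF U])
    have "S - ?U \<in> sets lborel" using S U by (intro sets.Diff) (auto intro: borel_open)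
    then show "S - ?U \<in> null_sets lborel"
      using negl by (simp add: negligible_iff_null_sets null_sets_completion_iff)
  qed
  also have "\<dots> = (\<integral>\<^sup>+i. emeasure lborel (?B i) \<partial>count_space C)"
    using C(1) d1 by (intro emeasure_UN_countable) auto
  also have "\<dots> = (\<integral>\<^sup>+i. emeasure lborel (T ` ?B i) \<partial>count_space C)"
    by (intro nn_integral_cong) (simp add: ball_eq)
  also have "\<dots> = emeasure lborel (\<Union>i\<in>C. T ` ?B i)"
    using C(1) d2 by (intro emeasure_UN_countable[symmetric])
      (auto simp: image_orthogonal_transformation_ball[OF T])
  also have "\<dots> \<le> emeasure lborel (T ` S)"
    using US TS by (intro emeasure_mono) auto
  finally show ?thesis .
qed

lemma lborel_distr_orthogonal:
  fixes T :: "'a::euclidean_space \<Rightarrow> 'a"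
  assumes T: "orthogonal_transformation T"
  shows "distr lborel borel T = lborel"
proof (rule lborel_eqI[symmetric])
  fix l u :: 'a assume le: "\<And>b. b \<in> Basis \<Longrightarrow> l \<bullet> b \<le> u \<bullet> b"
  have inv: "orthogonal_transformation (inv T)" and bij: "bij T"
    using T orthogonal_transformation_inv orthogonal_transformation_bij by blast+
  have lin: "linear T" "linear (inv T)" using T inv by (auto intro: orthogonal_transformation_linear)
  have cont: "continuous_on UNIV T"
    using lin(1) by (simp add: linear_continuous_on linear_conv_bounded_linear)
  have meas: "T \<in> borel_measurable borel"
    using cont by (rule borel_measurable_continuous_onI)
  have pre: "T -` box l u = inv T ` box l u"
    using bij by (rule bij_vimage_eq_inv_image)
  have op: "open (T -` box l u)" using open_vimage[OF open_box cont] .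
  have sets: "inv T ` box l u \<in> sets lborel"
    using op pre by (simp add: borel_open)
  have img: "T ` inv T ` box l u = box l u"
    using bij by (simp add: image_f_inv_f bij_is_surj)
  have "emeasure lborel (inv T ` box l u) = emeasure lborel (box l u)"
  proof (rule antisym)
    show "emeasure lborel (inv T ` box l u) \<le> emeasure lborel (box l u)"
      using emeasure_orthogonal_image_open_ge[OF T, of "inv T ` box l u"] op pre img by simp
    show "emeasure lborel (box l u) \<le> emeasure lborel (inv T ` box l u)"
      using emeasure_orthogonal_image_open_ge[OF inv open_box sets] .
  qed
  then show "emeasure (distr lborel borel T) (box l u) = (\<Prod>b\<in>Basis. (u - l) \<bullet> b)"
    using meas le by (simp add: emeasure_distr pre emeasure_lborel_box_eq)
qed simp

lemma
  fixes T :: "'a::euclidean_space \<Rightarrow> 'a"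
  assumes T: "orthogonal_transformation T"
  shows lebesgue_measurable_orthogonal: "T \<in> lebesgue \<rightarrow>\<^sub>M lebesgue"
    and lebesgue_distr_orthogonal: "distr lebesgue lebesgue T = lebesgue"
proof -
  have meas: "T \<in> borel_measurable borel"
    using orthogonal_transformation_linear[OF T]
    by (intro borel_measurable_continuous_onI linear_continuous_on)
      (simp add: linear_conv_bounded_linear)
  have Tl: "T \<in> lebesgue \<rightarrow>\<^sub>M lborel"
    using meas by (simp add: measurable_completion)
  have eq: "distr lebesgue lborel T = lborel"
    using meas lborel_distr_orthogonal[OF T] by (simp add: distr_completion cong: distr_cong)
  show "T \<in> lebesgue \<rightarrow>\<^sub>M lebesgue"
    using Tl by (intro completion.measurable_completion2) (simp_all add: eq)
  have "completion (distr lebesgue lborel T) = distr lebesgue lebesgue T"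
    using Tl by (intro completion.completion_distr_eq) (simp_all add: eq)
  then show "distr lebesgue lebesgue T = lebesgue" by (simp add: eq)
qed

section \<open>Moments of radial weights\<close>

definition radial :: "('a::real_normed_vector \<Rightarrow> real) \<Rightarrow> bool" where
  "radial \<phi> \<longleftrightarrow> (\<forall>x y. norm x = norm y \<longrightarrow> \<phi> x = \<phi> y)"

lemma radial_integral_orthogonal:
  fixes \<phi> :: "'a::euclidean_space \<Rightarrow> real"
  assumes T: "orthogonal_transformation T" and \<phi>: "radial \<phi>"
    and f: "integrable lebesgue (\<lambda>x. f x * \<phi> x)"
  shows "(LINT x|lebesgue. f (T x) * \<phi> x) = (LINT x|lebesgue. f x * \<phi> x)"
proof -
  have *: "\<phi> (T x) = \<phi> x" for x
    using \<phi> orthogonal_transformation_norm[OF T] unfolding radial_def by blast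
  have "(LINT x|lebesgue. f x * \<phi> x) = (LINT x|distr lebesgue lebesgue T. f x * \<phi> x)"
    by (simp add: lebesgue_distr_orthogonal[OF T])
  also have "\<dots> = (LINT x|lebesgue. f (T x) * \<phi> (T x))"
    using f lebesgue_measurable_orthogonal[OF T] by (intro integral_distr) auto
  finally show ?thesis by (simp add: *)
qed

text \<open>
  A reflection of the coordinate plane of \<open>i\<close> and \<open>j\<close>. The choices \<open>(c, s) = (-1, 0)\<close>, \<open>(0, 1)\<close> and
  \<open>(1 / sqrt 2, 1 / sqrt 2)\<close> give a sign change, a transposition and the reflection that turns
  \<open>x\<^sub>i x\<^sub>j\<close> into \<open>(x\<^sub>i\<^sup>2 - x\<^sub>j\<^sup>2) / 2\<close>. Invariance under these three is all that the moments of
  degree two and four require.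
\<close>

definition plane_reflection :: "'n \<Rightarrow> 'n \<Rightarrow> real \<Rightarrow> real \<Rightarrow> real ^ 'n \<Rightarrow> real ^ 'n" where
  "plane_reflection i j c s x =
     (\<chi> k. if k = i then c * x $ i + s * x $ j else if k = j then s * x $ i - c * x $ j else x $ k)"

lemma orthogonal_plane_reflection:
  fixes i j :: "'n::finite"
  assumes ij: "i \<noteq> j" and cs: "c\<^sup>2 + s\<^sup>2 = 1"
  shows "orthogonal_transformation (plane_reflection i j c s)"
  unfolding orthogonal_transformation
proof (intro conjI allI)
  show "linear (plane_reflection i j c s)"
    by (rule linearI) (auto simp: plane_reflection_def vec_eq_iff algebra_simps)
  fix x :: "real ^ 'n"
  have split: "(\<Sum>k\<in>UNIV. (y $ k)\<^sup>2) = (y $ i)\<^sup>2 + (y $ j)\<^sup>2 + (\<Sum>k\<in>UNIV - {i, j}. (y $ k)\<^sup>2)"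
    for y :: "real ^ 'n"
    using ij sum.subset_diff[of "{i, j}" UNIV "\<lambda>k. (y $ k)\<^sup>2"] by simp
  let ?y = "plane_reflection i j c s x"
  have "(?y $ i)\<^sup>2 + (?y $ j)\<^sup>2 = (c\<^sup>2 + s\<^sup>2) * ((x $ i)\<^sup>2 + (x $ j)\<^sup>2)"
    using ij by (simp add: plane_reflection_def power2_eq_square algebra_simps)
  then have "(\<Sum>k\<in>UNIV. (?y $ k)\<^sup>2) = (\<Sum>k\<in>UNIV. (x $ k)\<^sup>2)"
    unfolding split cs by (auto simp: plane_reflection_def intro!: sum.cong)
  then show "norm ?y = norm x" by (simp add: norm_vec_def L2_set_def)
qed

locale radial_moments =
  fixes \<phi> :: "real ^ 'n::finite \<Rightarrow> real" and M :: "(real ^ 'n \<Rightarrow> real) \<Rightarrow> real"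
  assumes radial: "radial \<phi>" and card: "CARD('n) \<ge> 2"
  defines "M \<equiv> \<lambda>f. LINT x|lebesgue. f x * \<phi> x"
begin

lemma reflect:
  assumes "i \<noteq> j" "c\<^sup>2 + s\<^sup>2 = 1" "integrable lebesgue (\<lambda>x. f x * \<phi> x)"
  shows "M (\<lambda>x. f (plane_reflection i j c s x)) = M f"
  unfolding M_def
  by (rule radial_integral_orthogonal[OF orthogonal_plane_reflection[OF assms(1,2)] radial assms(3)])

lemma odd_eq_0:
  assumes "\<And>x. f (- x) = - f x" "integrable lebesgue (\<lambda>x. f x * \<phi> x)"
  shows "M f = 0"
  using radial_integral_orthogonal[OF _ radial assms(2), of uminus]
    orthogonal_transformation_neg[THEN iffD2, OF orthogonal_transformation_id]
  unfolding M_def by (simp add: assms(1))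

lemma odd_coordinate_eq_0:
  assumes "\<And>x. f (\<chi> k. if k = i then - x $ k else x $ k) = - f x"
    and "integrable lebesgue (\<lambda>x. f x * \<phi> x)"
  shows "M f = 0"
proof -
  obtain j where "i \<noteq> j"
    using card card_le_Suc0_iff_eq[of "UNIV :: 'n set"] by (metis UNIV_I finite not_less_eq_eq numeral_2_eq_2)
  then have "M (\<lambda>x. f (plane_reflection i j (-1) 0 x)) = M f"
    using assms(2) by (intro reflect) auto
  moreover have "plane_reflection i j (-1) 0 x = (\<chi> k. if k = i then - x $ k else x $ k)" for x
    using \<open>i \<noteq> j\<close> by (auto simp: plane_reflection_def vec_eq_iff)
  ultimately have "M (\<lambda>x. - f x) = M f" using assms(1) by simp
  then show ?thesis unfolding M_def by simp
qed

lemma second_moment: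
  assumes int: "\<And>i j. integrable lebesgue (\<lambda>x. (x $ i * x $ j) * \<phi> x)"
  shows "M (\<lambda>x. x $ i * x $ j) = (if i = j then M (\<lambda>x. (x $ m)\<^sup>2) else 0)"
proof (cases "i = j")
  case False
  then show ?thesis
    using odd_coordinate_eq_0[OF _ int[of i j], of i] by simp
next
  case True
  have "M (\<lambda>x. x $ i * x $ i) = M (\<lambda>x. x $ m * x $ m)"
  proof (cases "i = m")
    case False
    show ?thesis
      using reflect[OF False _ int[of m m], of 0 1] False by (simp add: plane_reflection_def)
  qed simp
  with True show ?thesis by (simp add: power2_eq_square)
qed

text \<open>
  Sign changes kill every moment in which some coordinate has odd degree, transpositions identify
  the moments of the same shape, and comparing \<open>x\<^sub>i\<^sup>2 x\<^sub>j\<^sup>2\<close> with \<open>(x\<^sub>i\<^sup>2 - x\<^sub>j\<^sup>2)\<^sup>2 / 4\<close> shows that the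
  moment of \<open>x\<^sub>i\<^sup>4\<close> is 3 times that of \<open>x\<^sub>i\<^sup>2 x\<^sub>j\<^sup>2\<close>.
\<close>

lemma fourth_moment:
  assumes int: "\<And>i j k l. integrable lebesgue (\<lambda>x. (x $ i * x $ j * x $ k * x $ l) * \<phi> x)"
    and ab: "a \<noteq> b"
  shows "M (\<lambda>x. x $ i * x $ j * x $ k * x $ l) =
    M (\<lambda>x. (x $ a)\<^sup>2 * (x $ b)\<^sup>2) *
      (of_bool (i = j \<and> k = l) + of_bool (i = k \<and> j = l) + of_bool (i = l \<and> j = k))"
proof -
  define m where "m i j k l = M (\<lambda>x. x $ i * x $ j * x $ k * x $ l)" for i j k l
  define \<epsilon> :: "'n \<Rightarrow> 'n \<Rightarrow> real" where "\<epsilon> p i = (if i = p then -1 else 1)" for p i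
  have perm: "m i j k l = m j i k l" "m i j k l = m i k j l" "m i j k l = m i j l k" for i j k l
    unfolding m_def by (simp_all add: ac_simps)
  have zero: "m i j k l = 0" if "\<epsilon> p i * \<epsilon> p j * \<epsilon> p k * \<epsilon> p l = -1" for p i j k l
  proof -
    let ?R = "\<lambda>x :: real ^ 'n. \<chi> k. if k = p then - x $ k else x $ k"
    have "?R x $ i * ?R x $ j * ?R x $ k * ?R x $ l = - (x $ i * x $ j * x $ k * x $ l)" for x
    proof -
      have "?R x $ q = \<epsilon> p q * x $ q" for q by (simp add: \<epsilon>_def)
      then have "?R x $ i * ?R x $ j * ?R x $ k * ?R x $ l
          = (\<epsilon> p i * \<epsilon> p j * \<epsilon> p k * \<epsilon> p l) * (x $ i * x $ j * x $ k * x $ l)"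
        by (simp only: ac_simps)
      then show ?thesis by (simp only: that)
    qed
    then show ?thesis
      unfolding m_def by (rule odd_coordinate_eq_0[where i = p, OF _ int])
  qed
  have swap: "m i i j j = m k k j j" if "i \<noteq> j" "k \<noteq> j" for i j k
  proof (cases "i = k")
    case False
    show ?thesis
      unfolding m_def using reflect[OF False _ int[of k k j j], of 0 1] that False
      by (simp add: plane_reflection_def)
  qed simp
  have flip: "m i i j j = m j j i i" for i j by (metis perm)
  have pair: "m i i j j = m a a b b" if "i \<noteq> j" for i j
  proof (cases "j = a")
    case True
    then show ?thesis using swap[of i a b] flip[of b a] ab that by simp
  next
    case False
    then show ?thesis using swap[of i j a] flip[of a j] swap[of j a b] flip[of b a] ab that by simp
  qed
  have quart: "m i i i i = 3 * m a a b b" for i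
  proof -
    obtain j where ij: "i \<noteq> j" using ab by metis
    define c where "c = sqrt (1 / 2)"
    have cc: "c * c = 1 / 2" by (simp add: c_def)
    then have c1: "c\<^sup>2 + c\<^sup>2 = 1" by (simp add: power2_eq_square)
    have e: "(c * x + c * y) * (c * x + c * y) * (c * x - c * y) * (c * x - c * y)
        = 1 / 4 * (x * x * x * x) + 1 / 4 * (y * y * y * y) - 1 / 2 * (x * x * y * y)" for x y
    proof -
      have "(c * x + c * y) * (c * x + c * y) * (c * x - c * y) * (c * x - c * y)
        = (c * c) * (c * c) * ((x + y) * (x + y) * (x - y) * (x - y))"
        by (simp add: algebra_simps)
      then show ?thesis by (simp add: cc algebra_simps)
    qed
    have "m i i j j = M (\<lambda>x. 1 / 4 * (x $ i * x $ i * x $ i * x $ i)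
        + 1 / 4 * (x $ j * x $ j * x $ j * x $ j) - 1 / 2 * (x $ i * x $ i * x $ j * x $ j))"
      unfolding m_def using reflect[OF ij c1 int[of i i j j]] ij
      by (simp add: plane_reflection_def e)
    also have "\<dots> = 1 / 4 * m i i i i + 1 / 4 * m j j j j - 1 / 2 * m i i j j"
      using int[of i i i i] int[of j j j j] int[of i i j j]
      unfolding m_def M_def by (simp add: left_diff_distrib distrib_right mult.assoc)
    finally have 1: "6 * m i i j j = m i i i i + m j j j j" by simp
    have "m i i i i = m j j j j"
      unfolding m_def using reflect[OF ij _ int[of j j j j], of 0 1] ij
      by (simp add: plane_reflection_def)
    with 1 pair[OF ij] show ?thesis by simp
  qed
  have "m i j k l = m a a b b *
      (of_bool (i = j \<and> k = l) + of_bool (i = k \<and> j = l) + of_bool (i = l \<and> j = k))"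
  proof (cases "i = j \<and> k = l \<or> i = k \<and> j = l \<or> i = l \<and> j = k")
    case True
    then consider "i = j" "k = l" "i = k" | "i = j" "k = l" "i \<noteq> k"
      | "i = k" "j = l" "i \<noteq> j" | "i = l" "j = k" "i \<noteq> j" by metis
    then show ?thesis
    proof cases
      case 1
      then show ?thesis using quart[of i] by simp
    next
      case 2
      then show ?thesis using pair[of i k] by simp
    next
      case 3
      then show ?thesis using perm(2)[of i j i j] pair[of i j] by simp
    next
      case 4
      then show ?thesis using perm(3)[of i j j i] perm(2)[of i j i j] pair[of i j] by simp
    qed
  next
    case False
    then have "\<epsilon> i i * \<epsilon> i j * \<epsilon> i k * \<epsilon> i l = -1 \<or> \<epsilon> j i * \<epsilon> j j * \<epsilon> j k * \<epsilon> j l = -1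
      \<or> \<epsilon> k i * \<epsilon> k j * \<epsilon> k k * \<epsilon> k l = -1"
      unfolding \<epsilon>_def by (auto split: if_splits)
    then have "m i j k l = 0" using zero by blast
    moreover have "\<not> (i = j \<and> k = l)" "\<not> (i = k \<and> j = l)" "\<not> (i = l \<and> j = k)"
      using False by blast+
    ultimately show ?thesis by (simp only: of_bool_eq if_False) simp
  qed
  then show ?thesis by (simp add: m_def power2_eq_square mult.assoc)
qed

end

section \<open>Polynomial functions\<close>

lemma finite_exponents: "finite {\<alpha> :: 'n::finite \<Rightarrow> nat. sum \<alpha> UNIV \<le> d}"
proof (rule finite_subset)
  show "{\<alpha> :: 'n \<Rightarrow> nat. sum \<alpha> UNIV \<le> d} \<subseteq> (UNIV \<rightarrow>\<^sub>E {..d})"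
  proof (intro subsetI PiE_I)
    fix \<alpha> :: "'n \<Rightarrow> nat" and i assume "\<alpha> \<in> {\<alpha>. sum \<alpha> UNIV \<le> d}"
    moreover have "\<alpha> i \<le> sum \<alpha> UNIV" by (rule member_le_sum) auto
    ultimately show "\<alpha> i \<in> {..d}" by simp
  qed simp
qed (simp add: finite_PiE)

lemma poly_funs_add: "f \<in> poly_funs d \<Longrightarrow> g \<in> poly_funs d \<Longrightarrow> (\<lambda>x. f x + g x) \<in> poly_funs d"
proof -
  assume "f \<in> poly_funs d" "g \<in> poly_funs d"
  then obtain c c' where
    "f = (\<lambda>x. \<Sum>\<alpha> | sum \<alpha> UNIV \<le> d. c \<alpha> * monomial_fun \<alpha> x)"
    "g = (\<lambda>x. \<Sum>\<alpha> | sum \<alpha> UNIV \<le> d. c' \<alpha> * monomial_fun \<alpha> x)"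
    unfolding poly_funs_def by auto
  then have "(\<lambda>x. f x + g x)
      = (\<lambda>x. \<Sum>\<alpha> | sum \<alpha> UNIV \<le> d. (c \<alpha> + c' \<alpha>) * monomial_fun \<alpha> x)"
    by (simp add: sum.distrib distrib_right)
  then show ?thesis
    unfolding poly_funs_def by (auto intro!: exI[of _ "\<lambda>\<alpha>. c \<alpha> + c' \<alpha>"])
qed

lemma poly_funs_cmult: "f \<in> poly_funs d \<Longrightarrow> (\<lambda>x. a * f x) \<in> poly_funs d"
proof -
  assume "f \<in> poly_funs d"
  then obtain c where "f = (\<lambda>x. \<Sum>\<alpha> | sum \<alpha> UNIV \<le> d. c \<alpha> * monomial_fun \<alpha> x)"
    unfolding poly_funs_def by auto
  then have "(\<lambda>x. a * f x) = (\<lambda>x. \<Sum>\<alpha> | sum \<alpha> UNIV \<le> d. (a * c \<alpha>) * monomial_fun \<alpha> x)"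
    by (simp add: sum_distrib_left mult.assoc)
  then show ?thesis
    unfolding poly_funs_def by (auto intro!: exI[of _ "\<lambda>\<alpha>. a * c \<alpha>"])
qed

lemma poly_funs_sum: "(\<And>i. i \<in> I \<Longrightarrow> f i \<in> poly_funs d) \<Longrightarrow> (\<lambda>x. \<Sum>i\<in>I. f i x) \<in> poly_funs d"
proof (induction I rule: infinite_finite_induct)
  case (insert i I)
  then show ?case using poly_funs_add[of "f i" d "\<lambda>x. \<Sum>i\<in>I. f i x"] by simp
qed (use poly_funs_cmult[where a = 0 and d = d] in \<open>auto simp: poly_funs_def intro!: exI[of _ "\<lambda>_. 0"]\<close>)

lemma monomial_fun_in_poly_funs:
  assumes "sum \<alpha> UNIV \<le> d"
  shows "monomial_fun \<alpha> \<in> poly_funs d"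
proof -
  have "(\<Sum>\<beta> | sum \<beta> UNIV \<le> d. of_bool (\<beta> = \<alpha>) * monomial_fun \<beta> x) = monomial_fun \<alpha> x" for x
  proof -
    have "(\<Sum>\<beta> | sum \<beta> UNIV \<le> d. of_bool (\<beta> = \<alpha>) * monomial_fun \<beta> x)
      = (\<Sum>\<beta>\<in>{\<alpha>}. of_bool (\<beta> = \<alpha>) * monomial_fun \<beta> x)"
      using assms finite_exponents by (intro sum.mono_neutral_right) auto
    then show ?thesis by simp
  qed
  then show ?thesis
    unfolding poly_funs_def mem_Collect_eq
    by (intro exI[of _ "\<lambda>\<beta>. of_bool (\<beta> = \<alpha>)"]) (simp add: fun_eq_iff)
qed

lemma poly_funs_mult:
  fixes f g :: "real ^ 'n::finite \<Rightarrow> real"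
  assumes "f \<in> poly_funs d" "g \<in> poly_funs d'" "d + d' \<le> D"
  shows "(\<lambda>x. f x * g x) \<in> poly_funs D"
proof -
  from assms obtain c c' where
    "f = (\<lambda>x. \<Sum>\<alpha> | sum \<alpha> UNIV \<le> d. c \<alpha> * monomial_fun \<alpha> x)"
    "g = (\<lambda>x. \<Sum>\<alpha> | sum \<alpha> UNIV \<le> d'. c' \<alpha> * monomial_fun \<alpha> x)"
    unfolding poly_funs_def by auto
  moreover have "monomial_fun (\<lambda>i. \<alpha> i + \<beta> i) x = monomial_fun \<alpha> x * monomial_fun \<beta> x"
    for \<alpha> \<beta> and x :: "real ^ 'n"
    by (simp add: monomial_fun_def power_add prod.distrib)
  ultimately have "(\<lambda>x. f x * g x) = (\<lambda>x. \<Sum>\<alpha> | sum \<alpha> UNIV \<le> d. \<Sum>\<beta> | sum \<beta> UNIV \<le> d'.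
      c \<alpha> * (c' \<beta> * monomial_fun (\<lambda>i. \<alpha> i + \<beta> i) x))"
    by (simp add: sum_product) (simp only: ac_simps)
  moreover have "\<dots> \<in> poly_funs D"
    using assms(3) by (intro poly_funs_sum poly_funs_cmult monomial_fun_in_poly_funs)
      (simp add: sum.distrib)
  ultimately show ?thesis by simp
qed

lemma poly_funs_const: "(\<lambda>x. c) \<in> poly_funs d"
  using poly_funs_cmult[OF monomial_fun_in_poly_funs[of "\<lambda>_. 0" d], of c]
  by (simp add: monomial_fun_def)

lemma poly_funs_coord: "(\<lambda>x. x $ i) \<in> poly_funs 1"
proof -
  have "monomial_fun (\<lambda>j. of_bool (j = i)) = (\<lambda>x. x $ i)"
    by (auto simp: monomial_fun_def fun_eq_iff of_bool_def if_distrib[where f = "power _"] prod.delta' cong: if_cong)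
  then show ?thesis
    using monomial_fun_in_poly_funs[of "\<lambda>j. of_bool (j = i)" 1] by simp
qed

lemma poly_funs_quadratic: "2 \<le> d \<Longrightarrow> (\<lambda>x. x $ i * x $ j) \<in> poly_funs d"
  by (rule poly_funs_mult[OF poly_funs_coord poly_funs_coord]) simp

lemma poly_funs_quartic: "4 \<le> d \<Longrightarrow> (\<lambda>x. x $ i * x $ j * x $ k * x $ l) \<in> poly_funs d"
  by (rule poly_funs_mult[OF poly_funs_mult[OF poly_funs_quadratic[OF order_refl] poly_funs_coord
        order_refl] poly_funs_coord]) simp

text \<open>
  Listing the variables of a monomial with repetition lets moment identities that are indexed by
  tuples of coordinates be applied to it.
\<close>

lemma monomial_fun_eq_prod_list:
  fixes \<alpha> :: "'n::finite \<Rightarrow> nat"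
  obtains xs where "length xs = sum \<alpha> UNIV" "monomial_fun \<alpha> = (\<lambda>x. \<Prod>i\<leftarrow>xs. x $ i)"
proof -
  have "\<exists>xs. length xs = d \<and> monomial_fun \<alpha> = (\<lambda>x. \<Prod>i\<leftarrow>xs. x $ i)" if "sum \<alpha> UNIV = d" for d
    using that
  proof (induction d arbitrary: \<alpha>)
    case 0
    then show ?case by (auto simp: monomial_fun_def)
  next
    case (Suc d)
    then obtain i where i: "\<alpha> i \<noteq> 0" by (metis nat.distinct(1) sum.neutral)
    let ?\<beta> = "\<alpha>(i := \<alpha> i - 1)"
    have s: "sum f UNIV = f i + sum f (UNIV - {i})" for f :: "'n \<Rightarrow> nat"
      by (simp add: sum.remove)
    have "sum ?\<beta> UNIV = d"
      using Suc.prems i s[of \<alpha>] s[of ?\<beta>] by (simp cong: sum.cong_simp)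
    then obtain xs where xs: "length xs = d" "monomial_fun ?\<beta> = (\<lambda>x. \<Prod>i\<leftarrow>xs. x $ i)"
      using Suc.IH by blast
    have "monomial_fun \<alpha> x = x $ i * monomial_fun ?\<beta> x" for x
    proof -
      let ?R = "\<Prod>j\<in>UNIV - {i}. (x $ j) ^ \<alpha> j"
      have "monomial_fun \<alpha> x = (x $ i) ^ \<alpha> i * ?R"
        unfolding monomial_fun_def by (rule prod.remove) auto
      moreover have "monomial_fun ?\<beta> x = (x $ i) ^ ?\<beta> i * (\<Prod>j\<in>UNIV - {i}. (x $ j) ^ ?\<beta> j)"
        unfolding monomial_fun_def by (rule prod.remove) auto
      moreover have "(\<Prod>j\<in>UNIV - {i}. (x $ j) ^ ?\<beta> j) = ?R" by (rule prod.cong) auto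
      moreover have "(x $ i) ^ \<alpha> i = x $ i * (x $ i) ^ ?\<beta> i"
        using i by (simp add: power_eq_if)
      ultimately show ?thesis by (simp only: mult.assoc)
    qed
    with xs show ?case by (intro exI[of _ "i # xs"]) auto
  qed
  then show thesis using that by blast
qed

section \<open>Lower bound for the number of points\<close>

text \<open>
  The evaluations \<open>G \<bullet> u x\<close> at points of \<open>S \<union> T\<close> separate the vectors \<open>G\<close> of the span, and the
  quadratic form with weights \<open>d\<close> on the points of \<open>S\<close> vanishes identically there. Where the form is
  nondegenerate an isotropic space has at most half the dimension, so points of \<open>S\<close> count one
  half and points of \<open>T\<close> count fully.

  Instead of restricting to spaces of functions on \<open>S\<close>, choose \<open>I\<close> such that the vectors \<open>u x\<close>,
  \<open>x \<in> I\<close>, form a basis. If \<open>(S - I) \<union> T\<close> had fewer points than the dimension, some nonzero \<open>G\<close>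
  would vanish on it; testing the form on \<open>G\<close> and the dual basis of \<open>I\<close> then shows that \<open>G\<close>
  vanishes on \<open>S \<inter> I\<close> as well, so \<open>G = 0\<close>.
\<close>

lemma isotropic_dim_bound:
  fixes u :: "'b \<Rightarrow> 'e::euclidean_space" and d :: "'b \<Rightarrow> real"
  assumes fin: "finite S" "finite T" and ST: "S \<inter> T = {}"
    and d: "\<And>x. x \<in> S \<Longrightarrow> d x \<noteq> 0"
    and iso: "\<And>G H. G \<in> span (u ` (S \<union> T)) \<Longrightarrow> H \<in> span (u ` (S \<union> T)) \<Longrightarrow>
      (\<Sum>x\<in>S. d x * (G \<bullet> u x) * (H \<bullet> u x)) = 0"
  shows "2 * dim (u ` (S \<union> T)) \<le> card S + 2 * card T"
proof -
  let ?U = "u ` (S \<union> T)"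
  obtain B where B: "B \<subseteq> ?U" "independent B" "?U \<subseteq> span B" "card B = dim ?U"
    using basis_exists by blast
  obtain I where I: "I \<subseteq> S \<union> T" "inj_on u I" "B = u ` I"
    using B(1) unfolding subset_image_inj by blast
  have spanB: "span B = span ?U"
    using B(1,3) by (meson span_minimal span_mono subspace_span subset_antisym)
  have finI: "finite I" using I(1) fin by (meson finite_UnI finite_subset)
  have cardI: "card I = dim ?U" using B(4) I by (simp add: card_image)
  have "dim ?U \<le> card (S - I) + card T"
  proof (rule ccontr)
    assume "\<not> ?thesis"
    moreover have "card (u ` ((S - I) \<union> T)) \<le> card (S - I) + card T"
      using fin by (meson card_Un_le card_image_le finite_Diff finite_UnI order_trans)
    moreover have "dim (u ` ((S - I) \<union> T)) \<le> card (u ` ((S - I) \<union> T))"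
      using fin by (intro dim_le_card') auto
    ultimately have less: "dim (u ` ((S - I) \<union> T)) < dim ?U" by linarith
    have "span (u ` ((S - I) \<union> T)) \<subseteq> span ?U" by (intro span_mono) auto
    moreover have "span (u ` ((S - I) \<union> T)) \<noteq> span ?U" using less by (metis dim_span less_irrefl)
    ultimately have "span (u ` ((S - I) \<union> T)) \<subset> span ?U" by blast
    then obtain G where G: "G \<noteq> 0" "G \<in> span ?U"
      and G0: "\<And>y. y \<in> span (u ` ((S - I) \<union> T)) \<Longrightarrow> orthogonal G y"
      using orthogonal_to_subspace_exists_gen by metis
    have Gz: "G \<bullet> u x = 0" if "x \<in> (S - I) \<union> T" for x
      using G0[of "u x"] that unfolding orthogonal_def by (blast intro: span_base)
    have Gz': "G \<bullet> u x0 = 0" if x0: "x0 \<in> S \<inter> I" for x0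
    proof -
      have "u x0 \<in> B" using x0 I(3) by blast
      then have notin: "u x0 \<notin> span (B - {u x0})" using B(2) unfolding dependent_def by blast
      have "span (B - {u x0}) \<subseteq> span B" by (intro span_mono) auto
      then have "span (B - {u x0}) \<subset> span B"
        using notin \<open>u x0 \<in> B\<close> span_base by blast
      \<comment> \<open>A multiple of the dual basis vector belonging to \<open>x0\<close>: it vanishes at the other points of \<open>I\<close>.\<close>
      then obtain H where H: "H \<noteq> 0" "H \<in> span B"
        and H0: "\<And>y. y \<in> span (B - {u x0}) \<Longrightarrow> orthogonal H y"
        using orthogonal_to_subspace_exists_gen by metis
      have Hz: "H \<bullet> u x = 0" if "x \<in> I" "x \<noteq> x0" for x
      proof -
        have "u x \<in> B - {u x0}" using that x0 I(2,3) by (auto dest: inj_onD)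
        from H0[OF span_base[OF this]] show ?thesis by (simp add: orthogonal_def)
      qed
      have "H \<bullet> u x0 \<noteq> 0"
      proof
        assume "H \<bullet> u x0 = 0"
        then have "orthogonal H (u x)" if "x \<in> I" for x
          using that Hz[of x] by (cases "x = x0") (auto simp: orthogonal_def)
        then have "\<And>y. y \<in> B \<Longrightarrow> orthogonal H y" unfolding I(3) by blast
        then have "orthogonal H H" by (rule orthogonal_to_span[OF H(2)])
        with H(1) show False by (simp add: orthogonal_def)
      qed
      moreover have "(\<Sum>x\<in>S. d x * (G \<bullet> u x) * (H \<bullet> u x))
          = (\<Sum>x\<in>{x0}. d x * (G \<bullet> u x) * (H \<bullet> u x))"
        using x0 fin Gz Hz by (intro sum.mono_neutral_right) auto
      moreover have "d x0 \<noteq> 0" using d x0 by blast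
      ultimately show ?thesis using iso[of G H] G(2) H(2) spanB by simp
    qed
    have "orthogonal G (u x)" if "x \<in> S \<union> T" for x
      using that Gz[of x] Gz'[of x] by (cases "x \<in> I") (auto simp: orthogonal_def)
    then have "\<And>y. y \<in> ?U \<Longrightarrow> orthogonal G y" by blast
    then have "orthogonal G G" by (rule orthogonal_to_span[OF G(2)])
    with G(1) show False by (simp add: orthogonal_def)
  qed
  moreover have "card S = card (S \<inter> I) + card (S - I)"
    using fin(1) by (metis card_Diff_subset_Int card_Int_Diff finite_Int)
  moreover have "card I \<le> card (S \<inter> I) + card T"
  proof -
    have "card I \<le> card ((S \<inter> I) \<union> T)" using I(1) fin by (intro card_mono) auto
    then show ?thesis using card_Un_le[of "S \<inter> I" T] by linarith
  qed
  ultimately show ?thesis using cardI by linarith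
qed

text \<open>
  Even polynomials of degree at most two are represented by pairs \<open>G\<close> of a symmetric matrix and a
  constant; the value at \<open>x\<close> is the inner product of \<open>G\<close> and \<open>quad_vec x\<close>. In this way evaluation is
  an inner product in a Euclidean space, and \<open>quad_vec x\<close> is itself symmetric.
\<close>

definition quad_vec :: "real ^ 'n \<Rightarrow> (real ^ 'n ^ 'n) \<times> real" where
  "quad_vec x = ((\<chi> i j. x $ i * x $ j), 1)"

definition sym_space :: "((real ^ 'n ^ 'n) \<times> real) set" where
  "sym_space = {G. \<forall>i j. fst G $ i $ j = fst G $ j $ i}"

lemma inner_quad_vec:
  "G \<bullet> quad_vec x = (\<Sum>i\<in>UNIV. \<Sum>j\<in>UNIV. fst G $ i $ j * (x $ i * x $ j)) + snd G"
  by (cases G) (simp add: quad_vec_def inner_vec_def)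

lemma inner_quad_vec_uminus [simp]: "G \<bullet> quad_vec (- x) = G \<bullet> quad_vec x"
  by (simp add: inner_quad_vec)

lemma inner_quad_vec_in_poly_funs: "(\<lambda>x. G \<bullet> quad_vec x) \<in> poly_funs 2"
  unfolding inner_quad_vec
  by (intro poly_funs_add poly_funs_sum poly_funs_cmult poly_funs_const poly_funs_quadratic order_refl)

lemma subspace_sym_space: "subspace sym_space"
  by (auto simp: subspace_def sym_space_def)

lemma quad_vec_in_sym_space: "quad_vec x \<in> sym_space"
  by (simp add: sym_space_def quad_vec_def mult.commute)

text \<open>
  Sets with at most two elements index an orthogonal family: one- and two-element sets stand for the
  diagonal and the pairs of off-diagonal positions, the empty set for the constant. The dimension is
  stated doubled to avoid division.
\<close>

lemma dim_sym_space_ge: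
  "CARD('n::finite)\<^sup>2 + CARD('n) + 2 \<le> 2 * dim (sym_space :: ((real ^ 'n ^ 'n) \<times> real) set)"
proof -
  define b :: "'n set \<Rightarrow> (real ^ 'n ^ 'n) \<times> real"
    where "b A = ((\<chi> i j. of_bool ({i, j} = A)), of_bool (A = {}))" for A
  define \<A> where "\<A> = {A :: 'n set. card A = 0} \<union> {A. card A = 1} \<union> {A. card A = 2}"
  have orth: "b A \<bullet> b A' = 0" if "A \<noteq> A'" for A A'
    using that by (auto simp: b_def inner_vec_def intro!: sum.neutral)
  have nz: "b A \<noteq> 0" if "A \<in> \<A>" for A
  proof -
    have "A = {} \<or> (\<exists>i j. A = {i, j})"
    proof -
      have "card A = 0 \<or> card A = 1 \<or> card A = 2" using that by (auto simp: \<A>_def)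
      then show ?thesis
        unfolding card_1_singleton_iff One_nat_def card_2_iff
        by (metis card_0_eq finite insert_absorb2)
    qed
    then show ?thesis
    proof (elim disjE exE)
      assume "A = {}"
      then have "snd (b A) = 1" by (simp add: b_def)
      then show ?thesis by auto
    next
      fix i j assume "A = {i, j}"
      then have "fst (b A) $ i $ j = 1" by (simp add: b_def)
      then show ?thesis by auto
    qed
  qed
  have inj: "inj_on b \<A>"
    using orth nz by (metis inj_onI inner_eq_zero_iff)
  have "independent (b ` \<A>)"
  proof (rule pairwise_orthogonal_independent)
    show "pairwise orthogonal (b ` \<A>)"
      unfolding pairwise_def orthogonal_def using orth by (metis imageE)
    show "0 \<notin> b ` \<A>" using nz by (metis imageE)
  qed
  moreover have "b ` \<A> \<subseteq> sym_space" by (auto simp: b_def sym_space_def insert_commute)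
  ultimately have "card (b ` \<A>) \<le> dim (sym_space :: ((real ^ 'n ^ 'n) \<times> real) set)"
    by (intro independent_card_le_dim)
  then have le: "card \<A> \<le> dim (sym_space :: ((real ^ 'n ^ 'n) \<times> real) set)"
    using inj by (simp add: card_image)
  have c: "card {A :: 'n set. card A = k} = CARD('n) choose k" for k
    using n_subsets[of "UNIV :: 'n set" k] by simp
  have "card \<A> = (CARD('n) choose 0) + (CARD('n) choose 1) + (CARD('n) choose 2)"
    unfolding \<A>_def c[symmetric] by (subst card_Un_disjoint; (subst card_Un_disjoint)?; auto)
  then have "2 * card \<A> = CARD('n)\<^sup>2 + CARD('n) + 2"
  proof -
    have "2 * (CARD('n) choose 2) = CARD('n) * (CARD('n) - 1)" by (simp add: choose_two)
    moreover have "CARD('n) * (CARD('n) - 1) + CARD('n) = CARD('n)\<^sup>2"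
      by (cases "CARD('n)") (auto simp: power2_eq_square)
    ultimately show ?thesis using \<open>card \<A> = _\<close> by simp
  qed
  with le show ?thesis by linarith
qed

lemma generic_linear_form:
  fixes X :: "'a::euclidean_space set"
  assumes "finite X" "0 \<notin> X"
  obtains v where "\<And>x. x \<in> X \<Longrightarrow> v \<bullet> x \<noteq> 0"
proof -
  have "negligible (\<Union>x\<in>X. {v. x \<bullet> v = 0})"
    using assms by (intro negligible_Union) (auto intro!: negligible_hyperplane)
  then have "(\<Union>x\<in>X. {v. x \<bullet> v = 0}) \<noteq> UNIV" using non_negligible_UNIV by auto
  then obtain v where "\<forall>x\<in>X. x \<bullet> v \<noteq> 0" by blast
  then show thesis using that[of v] by (simp add: inner_commute)
qed

text \<open>
  Repeated points are merged and vanishing weights are removed, so that weights become a function on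
  the whole space with support \<open>X\<close>.
\<close>

lemma cubature_formula_weights:
  fixes C :: "(real ^ 'n \<Rightarrow> real) \<Rightarrow> real"
  assumes "cubature_formula N C"
  obtains W X where "finite X" "card X \<le> N" "\<And>x. W x \<noteq> 0 \<longleftrightarrow> x \<in> X"
    "\<And>f. C f = (\<Sum>x\<in>X. W x * f x)"
proof -
  obtain w :: "nat \<Rightarrow> real" and x :: "nat \<Rightarrow> real ^ 'n"
    where C: "\<And>f. C f = (\<Sum>j=1..N. w j * f (x j))"
    using assms unfolding cubature_formula_def by auto
  define W where "W y = (\<Sum>j | j \<in> {1..N} \<and> x j = y. w j)" for y
  let ?X = "{y. W y \<noteq> 0}"
  have sub: "?X \<subseteq> x ` {1..N}"
  proof (rule subsetI, rule ccontr)
    fix y assume y: "y \<in> ?X" and "y \<notin> x ` {1..N}"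
    then have "{j. j \<in> {1..N} \<and> x j = y} = {}" by auto
    then have "W y = 0" unfolding W_def by (simp only: sum.empty)
    with y show False by simp
  qed
  show thesis
  proof (rule that[of ?X W])
    show "finite ?X" using sub finite_subset by blast
    show "card ?X \<le> N"
      using card_mono[OF _ sub] card_image_le[of "{1..N}" x] by simp
    fix f :: "real ^ 'n \<Rightarrow> real"
    have "C f = (\<Sum>y\<in>x ` {1..N}. \<Sum>j | j \<in> {1..N} \<and> x j = y. w j * f (x j))"
      unfolding C by (rule sum.image_gen) simp
    also have "\<dots> = (\<Sum>y\<in>x ` {1..N}. W y * f y)"
      unfolding W_def sum_distrib_right by (intro sum.cong) auto
    also have "\<dots> = (\<Sum>y\<in>?X. W y * f y)"
      using sub by (intro sum.mono_neutral_right) auto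
    finally show "C f = (\<Sum>y\<in>?X. W y * f y)" .
  qed simp
qed

text \<open>
  Moeller's lower bound for a centrally symmetric functional. Nodes are grouped into antipodal pairs
  \<open>\<plusminus>x\<close>, with \<open>x\<close> in a half-space \<open>v \<bullet> x > 0\<close> whose boundary contains no nonzero node. Two facts
  about the space \<open>sym_space\<close> of even polynomials of degree at most two are combined: by
  nondegeneracy of \<open>L\<close> the evaluations at the pairs (and at \<open>0\<close>, if it is a node) separate it;
  and since the formula annihilates the odd polynomials \<open>(v \<bullet> x) G(x) G'(x)\<close> of degree five, it is
  isotropic for the form with weights \<open>d x * (v \<bullet> x)\<close>, where \<open>d x = W x - W (- x)\<close>.

  A pair with \<open>d x \<noteq> 0\<close> may contribute just one node, but then it counts only one half in the
  isotropy bound. A pair with \<open>d x = 0\<close> contributes two nodes. Only the origin contributes one node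
  and counts fully, which is the reason for the loss of 1 in the bound \<open>N \<ge> 2 * dim sym_space - 1\<close>.
\<close>

lemma cubature_degree_five_lower_bound:
  fixes L C :: "(real ^ 'n::finite \<Rightarrow> real) \<Rightarrow> real"
  assumes odd: "\<And>f. f \<in> poly_funs 5 \<Longrightarrow> (\<And>x. f (- x) = - f x) \<Longrightarrow> L f = 0"
    and nondeg: "\<And>G. G \<in> sym_space \<Longrightarrow>
      (\<And>g. g \<in> poly_funs 2 \<Longrightarrow> L (\<lambda>x. (G \<bullet> quad_vec x) * g x) = 0) \<Longrightarrow> G = 0"
    and C: "cubature_of_degree L 5 N C"
  shows "CARD('n)\<^sup>2 + CARD('n) + 1 \<le> N"
proof -
  obtain W X where X: "finite X" "card X \<le> N" and WX: "\<And>x. W x \<noteq> 0 \<longleftrightarrow> x \<in> X"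
    and CW: "\<And>f. C f = (\<Sum>x\<in>X. W x * f x)"
    using C cubature_formula_weights unfolding cubature_of_degree_def by metis
  have CL: "C f = L f" if "f \<in> poly_funs 5" for f
    using C that unfolding cubature_of_degree_def by blast
  define Y where "Y = X \<union> uminus ` X - {0}"
  have finY: "finite Y" and Y0: "0 \<notin> Y" using X by (auto simp: Y_def)
  have Yneg: "- x \<in> Y \<longleftrightarrow> x \<in> Y" for x by (force simp: Y_def image_iff)
  obtain v where v: "\<And>x. x \<in> Y \<Longrightarrow> v \<bullet> x \<noteq> 0"
    using generic_linear_form[OF finY Y0] by blast
  define H where "H = {x \<in> Y. v \<bullet> x > 0}"
  have finH: "finite H" using finY by (simp add: H_def)
  have Hneg: "H \<inter> uminus ` H = {}" unfolding H_def by force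
  have YH: "Y = H \<union> uminus ` H"
  proof
    show "Y \<subseteq> H \<union> uminus ` H"
    proof
      fix x assume x: "x \<in> Y"
      show "x \<in> H \<union> uminus ` H"
      proof (cases "v \<bullet> x > 0")
        case True
        with x show ?thesis by (simp add: H_def)
      next
        case False
        then have "- x \<in> H" using x v[OF x] Yneg[of x] by (simp add: H_def)
        then show ?thesis by (metis UnI2 image_eqI minus_minus)
      qed
    qed
  qed (use Yneg in \<open>auto simp: H_def\<close>)
  define d where "d x = W x - W (- x)" for x
  define S where "S = {x \<in> H. d x \<noteq> 0}"
  define Z where "Z = X \<inter> {0}"
  \<comment> \<open>The origin is put with the pairs of equal weights because odd polynomials vanish there.\<close>
  define T where "T = (H - S) \<union> Z"
  have S_sub: "S \<subseteq> H" by (auto simp: S_def)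
  have HZ: "H \<inter> Z = {}" using Y0 by (auto simp: H_def Z_def)
  have ST: "S \<union> T = H \<union> Z" "S \<inter> T = {}" using S_sub HZ by (auto simp: T_def)
  have fin: "finite S" "finite T" "finite Z"
    using finH S_sub finite_subset by (auto simp: T_def Z_def)

  have antisym: "(\<Sum>x\<in>H. d x * f x) = 0" if f: "f \<in> poly_funs 5" "\<And>x. f (- x) = - f x" for f
  proof -
    have f0: "f 0 = 0" using f(2)[of 0] by simp
    have "0 = (\<Sum>x\<in>X. W x * f x)"
      using CL[OF f(1)] odd[OF f] CW by simp
    also have "\<dots> = (\<Sum>x\<in>Y. W x * f x)"
    proof (rule sum.mono_neutral_cong)
      show "\<And>i. i \<in> Y - X \<Longrightarrow> W i * f i = 0" using WX by auto
      show "\<And>i. i \<in> X - Y \<Longrightarrow> W i * f i = 0" using f0 by (auto simp: Y_def)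
    qed (use X finY in auto)
    also have "\<dots> = (\<Sum>x\<in>H. W x * f x) + (\<Sum>x\<in>uminus ` H. W x * f x)"
      unfolding YH using finH Hneg by (intro sum.union_disjoint) auto
    also have "(\<Sum>x\<in>uminus ` H. W x * f x) = (\<Sum>x\<in>H. - (W (- x) * f x))"
      by (subst sum.reindex) (auto simp: f(2))
    finally show ?thesis
      by (simp add: d_def left_diff_distrib sum_subtractf sum_negf)
  qed

  have iso: "(\<Sum>x\<in>S. (d x * (v \<bullet> x)) * (G \<bullet> quad_vec x) * (G' \<bullet> quad_vec x)) = 0" for G G'
  proof -
    have lin: "(\<lambda>x. v \<bullet> x) \<in> poly_funs 1"
      unfolding inner_vec_def inner_real_def by (intro poly_funs_sum poly_funs_cmult poly_funs_coord)
    have "(\<lambda>x. (v \<bullet> x) * ((G \<bullet> quad_vec x) * (G' \<bullet> quad_vec x))) \<in> poly_funs 5"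
      by (rule poly_funs_mult[OF lin poly_funs_mult[OF inner_quad_vec_in_poly_funs
            inner_quad_vec_in_poly_funs order_refl]]) simp
    then have "(\<Sum>x\<in>H. d x * ((v \<bullet> x) * ((G \<bullet> quad_vec x) * (G' \<bullet> quad_vec x)))) = 0"
      by (rule antisym) simp
    moreover have "(\<Sum>x\<in>H. d x * ((v \<bullet> x) * ((G \<bullet> quad_vec x) * (G' \<bullet> quad_vec x))))
      = (\<Sum>x\<in>S. d x * ((v \<bullet> x) * ((G \<bullet> quad_vec x) * (G' \<bullet> quad_vec x))))"
      using finH by (intro sum.mono_neutral_right) (auto simp: S_def)
    ultimately show ?thesis by (simp add: mult.assoc)
  qed

  have span_eq: "span (quad_vec ` (S \<union> T)) = sym_space"
  proof (rule ccontr)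
    assume neq: "span (quad_vec ` (S \<union> T)) \<noteq> sym_space"
    have "span (quad_vec ` (S \<union> T)) \<subseteq> (sym_space :: ((real ^ 'n ^ 'n) \<times> real) set)"
      using quad_vec_in_sym_space by (intro span_minimal subspace_sym_space) auto
    with neq have "span (quad_vec ` (S \<union> T)) \<subset> span (sym_space :: ((real ^ 'n ^ 'n) \<times> real) set)"
      using span_eq_iff[THEN iffD2, OF subspace_sym_space] by blast
    then obtain G where G: "G \<noteq> 0" "G \<in> span sym_space"
      and G0: "\<And>y. y \<in> span (quad_vec ` (S \<union> T)) \<Longrightarrow> orthogonal G y"
      using orthogonal_to_subspace_exists_gen by metis
    have GH: "G \<bullet> quad_vec x = 0" if "x \<in> H \<union> Z" for x
      using G0[of "quad_vec x"] that ST(1) unfolding orthogonal_def by (blast intro: span_base)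
    have GX: "G \<bullet> quad_vec x = 0" if "x \<in> X" for x
    proof (cases "x \<in> H \<union> Z")
      case False
      then have "x \<in> uminus ` H" using that YH by (auto simp: Y_def Z_def)
      then show ?thesis using GH by (auto simp: inner_quad_vec_uminus)
    qed (rule GH)
    have "G = 0"
    proof (rule nondeg)
      show "G \<in> sym_space" using G(2) subspace_sym_space by (metis span_eq_iff)
      fix g :: "real ^ 'n \<Rightarrow> real" assume "g \<in> poly_funs 2"
      then have "(\<lambda>x. (G \<bullet> quad_vec x) * g x) \<in> poly_funs 5"
        by (rule poly_funs_mult[OF inner_quad_vec_in_poly_funs]) simp
      then show "L (\<lambda>x. (G \<bullet> quad_vec x) * g x) = 0"
        using CL CW GX by (metis (mono_tags, lifting) mult_eq_0_iff sum.neutral)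
    qed
    with G(1) show False by simp
  qed

  have "2 * dim (quad_vec ` (S \<union> T)) \<le> card S + 2 * card T"
  proof (rule isotropic_dim_bound[where d = "\<lambda>x. d x * (v \<bullet> x)"])
    show "d x * (v \<bullet> x) \<noteq> 0" if "x \<in> S" for x using that by (auto simp: S_def H_def)
  qed (use fin ST iso in auto)
  moreover have "CARD('n)\<^sup>2 + CARD('n) + 2 \<le> 2 * dim (quad_vec ` (S \<union> T))"
    using dim_sym_space_ge[where 'n = 'n] span_eq by (metis dim_span)
  moreover have "card S + 2 * card T \<le> card X + 1"
  proof -
    let ?P = "{x \<in> H. x \<in> X}" and ?Q = "{x \<in> H. - x \<in> X}"
    have PQ: "card ?P + card ?Q \<ge> card S + 2 * card (H - S)"
    proof -
      have "H - S \<subseteq> ?P \<inter> ?Q"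
      proof
        fix x assume x: "x \<in> H - S"
        then have "W x = W (- x)" "x \<in> X \<or> - x \<in> X"
          by (auto simp: S_def d_def H_def Y_def)
        then show "x \<in> ?P \<inter> ?Q" using x WX by (metis (mono_tags, lifting) DiffD1 IntI mem_Collect_eq)
      qed
      then have "card (H - S) \<le> card (?P \<inter> ?Q)" using finH by (intro card_mono) auto
      moreover have "H \<subseteq> ?P \<union> ?Q" by (auto simp: H_def Y_def)
      then have "card H \<le> card (?P \<union> ?Q)" using finH by (intro card_mono) auto
      moreover have "card ?P + card ?Q = card (?P \<union> ?Q) + card (?P \<inter> ?Q)"
        using finH by (intro card_Un_Int) auto
      moreover have "card H = card S + card (H - S)"
        using finH S_sub by (metis card_Diff_subset card_mono finite_subset le_add_diff_inverse)
      ultimately show ?thesis by linarith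
    qed
    have "card (?P \<union> uminus ` ?Q \<union> Z) = card ?P + card ?Q + card Z"
    proof -
      have "?P \<inter> uminus ` ?Q = {}" using Hneg by blast
      moreover have "(?P \<union> uminus ` ?Q) \<inter> Z = {}" using HZ by (auto simp: Z_def)
      moreover have "card (uminus ` ?Q) = card ?Q" by (intro card_image) auto
      ultimately show ?thesis using finH fin by (simp add: card_Un_disjoint)
    qed
    moreover have "?P \<union> uminus ` ?Q \<union> Z \<subseteq> X" by (auto simp: Z_def)
    then have "card (?P \<union> uminus ` ?Q \<union> Z) \<le> card X" using X by (intro card_mono)
    moreover have "card T = card (H - S) + card Z"
      unfolding T_def using finH fin HZ by (intro card_Un_disjoint) auto
    moreover have "card Z \<le> 1" using card_mono[of "{0}" Z] by (simp add: Z_def)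
    ultimately show ?thesis using PQ by linarith
  qed
  ultimately show ?thesis using X(2) by linarith
qed

section \<open>The regular simplex and its edge midpoints\<close>

lemma sum_pairs:
  fixes h :: "nat \<Rightarrow> nat \<Rightarrow> real"
  assumes "\<And>k l. h k l = h l k"
  shows "(\<Sum>(k, l)\<in>{(k, l). 1 \<le> k \<and> k < l \<and> l \<le> N}. h k l)
    = ((\<Sum>k=1..N. \<Sum>l=1..N. h k l) - (\<Sum>k=1..N. h k k)) / 2"
proof -
  let ?P = "{(k, l). 1 \<le> k \<and> k < l \<and> l \<le> N}"
  let ?D = "(\<lambda>k. (k, k)) ` {1..N}"
  have fin: "finite ?P" by (rule finite_subset[of _ "{1..N} \<times> {1..N}"]) auto
  have "(\<Sum>(k, l)\<in>{1..N} \<times> {1..N}. h k l) = (\<Sum>(k, l)\<in>(?P \<union> prod.swap ` ?P) \<union> ?D. h k l)"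
    by (rule sum.cong) (force simp: image_iff)+
  also have "\<dots> = (\<Sum>(k, l)\<in>?P. h k l) + (\<Sum>(k, l)\<in>prod.swap ` ?P. h k l) + (\<Sum>(k, l)\<in>?D. h k l)"
    using fin by (subst sum.union_disjoint sum.union_disjoint; auto)+
  also have "(\<Sum>(k, l)\<in>prod.swap ` ?P. h k l) = (\<Sum>(k, l)\<in>?P. h k l)"
    by (subst sum.reindex) (auto simp: case_prod_beta assms intro!: sum.cong)
  also have "(\<Sum>(k, l)\<in>?D. h k l) = (\<Sum>k=1..N. h k k)"
    by (subst sum.reindex) (auto simp: inj_on_def)
  finally show ?thesis by (simp add: sum.cartesian_product)
qed

lemma sum_pairs_second:
  fixes p q :: "nat \<Rightarrow> real"
  assumes "sum p {1..N} = 0" "sum q {1..N} = 0"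
  shows "(\<Sum>(k, l)\<in>{(k, l). 1 \<le> k \<and> k < l \<and> l \<le> N}. (p k + p l) * (q k + q l))
    = (real N - 2) * (\<Sum>k=1..N. p k * q k)"
proof -
  have all: "(\<Sum>k=1..N. \<Sum>l=1..N. (p k + p l) * (q k + q l)) = 2 * real N * (\<Sum>k=1..N. p k * q k)"
    using assms by (simp add: algebra_simps sum.distrib flip: sum_distrib_left sum_distrib_right)
  have diag: "(\<Sum>k=1..N. (p k + p k) * (q k + q k)) = 4 * (\<Sum>k=1..N. p k * q k)"
    by (simp add: sum_distrib_left algebra_simps)
  have sym: "(p k + p l) * (q k + q l) = (p l + p k) * (q l + q k)" for k l
    by (simp only: add.commute)
  show ?thesis
    unfolding sum_pairs[OF sym] all diag by (simp add: field_simps)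
qed

text \<open>
  Expanding the product gives terms with four, three and two factors of the same index; those with
  three vanish because each sequence sums to \<open>0\<close>. What remains is the sum over single indices, with
  coefficient \<open>N - 8\<close>, and the three products of second-order sums. With \<open>N = n + 1\<close> the
  coefficient is \<open>n - 7\<close>, which is why the vertices drop out of the formula in dimension seven.
\<close>

lemma sum_pairs_fourth:
  fixes p q r s :: "nat \<Rightarrow> real"
  assumes z: "sum p {1..N} = 0" "sum q {1..N} = 0" "sum r {1..N} = 0" "sum s {1..N} = 0"
  shows "(\<Sum>(k, l)\<in>{(k, l). 1 \<le> k \<and> k < l \<and> l \<le> N}.
      (p k + p l) * (q k + q l) * (r k + r l) * (s k + s l))
    = (real N - 8) * (\<Sum>k=1..N. p k * q k * r k * s k)
      + (\<Sum>k=1..N. p k * q k) * (\<Sum>k=1..N. r k * s k)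
      + (\<Sum>k=1..N. p k * r k) * (\<Sum>k=1..N. q k * s k)
      + (\<Sum>k=1..N. p k * s k) * (\<Sum>k=1..N. q k * r k)"
proof -
  let ?S = "\<lambda>f :: nat \<Rightarrow> real. sum f {1..N}"
  have "(\<Sum>k=1..N. \<Sum>l=1..N. (p k + p l) * (q k + q l) * (r k + r l) * (s k + s l))
    = (\<Sum>k=1..N. \<Sum>l=1..N. (p k * q k * r k * s k + p l * q l * r l * s l)
       + (p k * q k * r k) * s l + (p k * q k * s k) * r l + (p k * r k * s k) * q l
       + (q k * r k * s k) * p l + p k * (q l * r l * s l) + q k * (p l * r l * s l)
       + r k * (p l * q l * s l) + s k * (p l * q l * r l)
       + (p k * q k) * (r l * s l) + (r k * s k) * (p l * q l)
       + (p k * r k) * (q l * s l) + (q k * s k) * (p l * r l)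
       + (p k * s k) * (q l * r l) + (q k * r k) * (p l * s l))"
    by (intro sum.cong refl) (simp add: algebra_simps)
  also have "\<dots> = 2 * real N * ?S (\<lambda>k. p k * q k * r k * s k)
      + 2 * (?S (\<lambda>k. p k * q k) * ?S (\<lambda>k. r k * s k))
      + 2 * (?S (\<lambda>k. p k * r k) * ?S (\<lambda>k. q k * s k))
      + 2 * (?S (\<lambda>k. p k * s k) * ?S (\<lambda>k. q k * r k))"
    by (simp only: sum.distrib sum_product[symmetric] z sum_constant) 
      (simp add: sum_distrib_left[symmetric])
  finally have all: "(\<Sum>k=1..N. \<Sum>l=1..N. (p k + p l) * (q k + q l) * (r k + r l) * (s k + s l)) = \<dots>" .
  have diag: "(\<Sum>k=1..N. (p k + p k) * (q k + q k) * (r k + r k) * (s k + s k))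
      = 16 * ?S (\<lambda>k. p k * q k * r k * s k)"
    unfolding sum_distrib_left by (intro sum.cong refl) (simp add: algebra_simps)
  have sym: "(p k + p l) * (q k + q l) * (r k + r l) * (s k + s l)
    = (p l + p k) * (q l + q k) * (r l + r k) * (s l + s k)" for k l
    by (simp only: add.commute)
  show ?thesis
    unfolding sum_pairs[OF sym] all diag by (simp add: field_simps)
qed

lemma a_coord_column:
  assumes i: "1 \<le> i" "i \<le> n"
  obtains u v where "\<And>r. a_coord n r i = (if i < r then - u else if i = r then v else 0)"
    "v = (real n + 1 - real i) * u" "v\<^sup>2 + (real n + 1 - real i) * u\<^sup>2 = (real n + 1) / real n"
proof
  define m where "m = real n - real i + 1"
  have m: "m \<ge> 1" "real n \<ge> 1" using i by (auto simp: m_def)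
  let ?u = "sqrt ((real n + 1) / (real n * (real n - real i + 2) * (real n - real i + 1)))"
  let ?v = "sqrt ((real n + 1) * (real n - real i + 1) / (real n * (real n - real i + 2)))"
  show "a_coord n r i = (if i < r then - ?u else if i = r then ?v else 0)" for r
    by (simp add: a_coord_def)
  have u: "?u = sqrt ((real n + 1) / (real n * (m + 1) * m))"
    and v: "?v = sqrt ((real n + 1) * m / (real n * (m + 1)))" by (simp_all add: m_def)
  have mm: "real n + 1 - real i = m" by (simp add: m_def)
  have "(real n + 1) * m / (real n * (m + 1)) = m\<^sup>2 * ((real n + 1) / (real n * (m + 1) * m))"
    using m by (simp add: divide_simps power2_eq_square)
  then show "?v = (real n + 1 - real i) * ?u"
    unfolding u v mm using m by (simp only: real_sqrt_mult real_sqrt_abs)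
  have "(real n + 1) * m / (real n * (m + 1)) + m * ((real n + 1) / (real n * (m + 1) * m))
     = (real n + 1) / real n"
    using m by (simp add: divide_simps) (simp add: algebra_simps)
  then show "?v\<^sup>2 + (real n + 1 - real i) * ?u\<^sup>2 = (real n + 1) / real n"
    unfolding u v mm using m by simp
qed

text \<open>
  Column \<open>i\<close> has \<open>i - 1\<close> zeros, then one entry \<open>v\<close>, then \<open>n + 1 - i\<close> entries \<open>- u\<close>. Two columns are
  orthogonal because the earlier one is constant on the support of the later one, which sums to \<open>0\<close>.
\<close>

lemma sum_a_coord:
  assumes i: "1 \<le> i" "i \<le> n"
  shows "(\<Sum>r=1..n+1. a_coord n r i) = 0"
    and "(\<Sum>r=1..n+1. a_coord n r i * a_coord n r i) = (real n + 1) / real n"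
    and "i < j \<Longrightarrow> j \<le> n \<Longrightarrow> (\<Sum>r=1..n+1. a_coord n r i * a_coord n r j) = 0"
proof -
  have col: "(\<Sum>r=1..n+1. f r) = (\<Sum>r=1..<i. f r) + f i + (\<Sum>r=i+1..n+1. f r)"
    if "1 \<le> i" "i \<le> n" for f :: "nat \<Rightarrow> real" and i
  proof -
    have "{1..n+1} = {1..<i} \<union> {i} \<union> {i+1..n+1}" using that by auto
    moreover have "sum f ({1..<i} \<union> {i} \<union> {i+1..n+1}) = sum f ({1..<i} \<union> {i}) + sum f {i+1..n+1}"
      by (rule sum.union_disjoint) auto
    moreover have "sum f ({1..<i} \<union> {i}) = sum f {1..<i} + sum f {i}"
      by (rule sum.union_disjoint) auto
    ultimately show ?thesis by simp
  qed
  have z: "(\<Sum>r=1..n+1. a_coord n r i) = 0" if i: "1 \<le> i" "i \<le> n" for i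
  proof -
    obtain u v where a: "\<And>r. a_coord n r i = (if i < r then - u else if i = r then v else 0)"
      and uv: "v = (real n + 1 - real i) * u"
      using a_coord_column[OF i] by metis
    show ?thesis
      unfolding col[OF i] by (simp add: a uv) (use i in \<open>simp add: of_nat_diff le_SucI algebra_simps\<close>)
  qed
  show "(\<Sum>r=1..n+1. a_coord n r i) = 0" by (rule z[OF i])
  obtain u v where a: "\<And>r. a_coord n r i = (if i < r then - u else if i = r then v else 0)"
    and uv: "v\<^sup>2 + (real n + 1 - real i) * u\<^sup>2 = (real n + 1) / real n"
    using a_coord_column[OF i] by metis
  show "(\<Sum>r=1..n+1. a_coord n r i * a_coord n r i) = (real n + 1) / real n"
    unfolding col[OF i] uv[symmetric]
    by (simp add: a) (use i in \<open>simp add: of_nat_diff le_SucI algebra_simps power2_eq_square\<close>)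
  show "(\<Sum>r=1..n+1. a_coord n r i * a_coord n r j) = 0" if "i < j" "j \<le> n"
  proof -
    have "(\<Sum>r=1..n+1. a_coord n r i * a_coord n r j) = (\<Sum>r=1..n+1. - u * a_coord n r j)"
    proof (rule sum.cong)
      fix r
      have "a_coord n r j = 0" if "r < j" using that by (simp add: a_coord_def)
      then show "a_coord n r i * a_coord n r j = - u * a_coord n r j"
        using a[of r] \<open>i < j\<close> by (cases "r < j") auto
    qed simp
    also have "\<dots> = - u * (\<Sum>r=1..n+1. a_coord n r j)" by (simp only: sum_distrib_left)
    finally show ?thesis using z[of j] i that by simp
  qed
qed

lemma
  fixes e :: "nat \<Rightarrow> 'n::finite"
  assumes e: "bij_betw e {1..CARD('n)} UNIV"
  shows sum_a_vec: "(\<Sum>r=1..CARD('n)+1. a_vec e r $ i) = 0"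
    and sum_a_vec_mult: "(\<Sum>r=1..CARD('n)+1. a_vec e r $ i * a_vec e r $ j)
      = of_bool (i = j) * (real CARD('n) + 1) / real CARD('n)"
proof -
  let ?n = "CARD('n)"
  let ?\<kappa> = "the_inv_into {1..?n} e"
  have b: "bij_betw ?\<kappa> UNIV {1..?n}" using e by (rule bij_betw_the_inv_into)
  then have \<kappa>: "1 \<le> ?\<kappa> k" "?\<kappa> k \<le> ?n" for k by (auto simp: bij_betw_def)
  have inj: "?\<kappa> i = ?\<kappa> j \<longleftrightarrow> i = j" for i j using b by (auto simp: bij_betw_def inj_on_def)
  have av: "a_vec e r $ k = a_coord ?n r (?\<kappa> k)" for r k by (simp add: a_vec_def)
  show "(\<Sum>r=1..?n+1. a_vec e r $ i) = 0"
    unfolding av by (rule sum_a_coord(1)[OF \<kappa>])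
  show "(\<Sum>r=1..?n+1. a_vec e r $ i * a_vec e r $ j)
      = of_bool (i = j) * (real ?n + 1) / real ?n"
  proof -
    consider "?\<kappa> i < ?\<kappa> j" | "?\<kappa> j < ?\<kappa> i" | "?\<kappa> i = ?\<kappa> j" by linarith
    then show ?thesis
    proof cases
      case 1
      then show ?thesis
        unfolding av using sum_a_coord(3)[OF \<kappa> 1 \<kappa>(2)] by auto
    next
      case 2
      then show ?thesis
        unfolding av using sum_a_coord(3)[OF \<kappa> 2 \<kappa>(2)] by (auto simp: mult.commute)
    next
      case 3
      then show ?thesis
        unfolding av using sum_a_coord(2)[OF \<kappa>[of j]] inj by simp
    qed
  qed
qed

lemma cubature_formula_add:
  assumes "cubature_formula N C" "cubature_formula M D"
  shows "cubature_formula (N + M) (\<lambda>f. C f + D f)"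
proof -
  obtain w x where C: "\<And>f. C f = (\<Sum>j=1..N. w j * f (x j))"
    using assms(1) unfolding cubature_formula_def by auto
  obtain w' x' where D: "\<And>f. D f = (\<Sum>j=1..M. w' j * f (x' j))"
    using assms(2) unfolding cubature_formula_def by auto
  let ?w = "\<lambda>j. if j \<le> N then w j else w' (j - N)"
  let ?x = "\<lambda>j. if j \<le> N then x j else x' (j - N)"
  have "C f + D f = (\<Sum>j=1..N+M. ?w j * f (?x j))" for f
  proof -
    have "(\<Sum>j=1..N+M. ?w j * f (?x j))
      = (\<Sum>j=1..N. ?w j * f (?x j)) + (\<Sum>j=N+1..N+M. ?w j * f (?x j))"
      by (rule sum.ub_add_nat) simp
    also have "(\<Sum>j=N+1..N+M. ?w j * f (?x j)) = (\<Sum>j=1..M. ?w (j + N) * f (?x (j + N)))"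
      using sum.shift_bounds_cl_nat_ivl[of "\<lambda>j. ?w j * f (?x j)" 1 N M] by (simp add: add.commute)
    also have "\<dots> = D f" unfolding D by (intro sum.cong) auto
    also have "(\<Sum>j=1..N. ?w j * f (?x j)) = C f" unfolding C by (intro sum.cong) auto
    finally show ?thesis by simp
  qed
  then show ?thesis
    unfolding cubature_formula_def by (intro exI[of _ ?w] exI[of _ ?x]) simp
qed

lemma cubature_formula_sum:
  assumes "finite I"
  shows "cubature_formula (card I) (\<lambda>f. \<Sum>i\<in>I. w i * f (x i))"
proof -
  obtain h where h: "bij_betw h {1..card I} I"
    using ex_bij_betw_nat_finite_1[OF assms] by blast
  have "(\<Sum>i\<in>I. w i * f (x i)) = (\<Sum>j=1..card I. w (h j) * f (x (h j)))" for f
    by (rule sum.reindex_bij_betw[OF h, symmetric])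
  then show ?thesis
    unfolding cubature_formula_def
    by (intro exI[of _ "\<lambda>j. w (h j)"] exI[of _ "\<lambda>j. x (h j)"]) auto
qed

text \<open>
  The formula with arbitrary weights and an arbitrary radius, so that its moments can be computed
  before the parameters are fitted.
\<close>

definition simplex_rule ::
  "(nat \<Rightarrow> 'n::finite) \<Rightarrow> real \<Rightarrow> real \<Rightarrow> real \<Rightarrow> real \<Rightarrow> (real ^ 'n \<Rightarrow> real) \<Rightarrow> real" where
  "simplex_rule e A B c \<tau> f =
      A * (\<Sum>j = 1..CARD('n) + 1. f (\<tau> *\<^sub>R a_vec e j) + f (- \<tau> *\<^sub>R a_vec e j))
    + B * (\<Sum>(k, l) \<in> {(k, l). 1 \<le> k \<and> k < l \<and> l \<le> CARD('n) + 1}.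
             f (\<tau> *\<^sub>R b_vec e k l) + f (- \<tau> *\<^sub>R b_vec e k l))
    + c * f 0"

lemma
  fixes e :: "nat \<Rightarrow> 'n::finite" and A B c \<tau> :: real
  defines "n \<equiv> CARD('n)" and "C \<equiv> simplex_rule e A B c \<tau>"
  shows simplex_rule_cubature_formula: "cubature_formula (n\<^sup>2 + 3 * n + 3) C"
    and simplex_rule_cubature_formula_A_0: "A = 0 \<Longrightarrow> cubature_formula (n\<^sup>2 + n + 1) C"
    and simplex_rule_odd: "(\<And>x. f (- x) = - f x) \<Longrightarrow> C f = 0"
    and simplex_rule_one: "C (\<lambda>x. 1) = 2 * (real n + 1) * (A + B * real n / 2) + c"
    and simplex_rule_second: "bij_betw e {1..n} UNIV \<Longrightarrow> 2 \<le> n \<Longrightarrow> C (\<lambda>x. x $ i * x $ j)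
      = 2 * \<tau>\<^sup>2 * (A + B * real n / 2) * (real n + 1) / real n * of_bool (i = j)"
    and simplex_rule_fourth: "bij_betw e {1..n} UNIV \<Longrightarrow> 2 \<le> n \<Longrightarrow>
      A + B * (real n)\<^sup>2 / (4 * (real n - 1)\<^sup>2) * (real n - 7) = 0 \<Longrightarrow>
      C (\<lambda>x. x $ i * x $ j * x $ k * x $ l) = \<tau> ^ 4 * B * (real n + 1)\<^sup>2 / (2 * (real n - 1)\<^sup>2) *
        (of_bool (i = j \<and> k = l) + of_bool (i = k \<and> j = l) + of_bool (i = l \<and> j = k))"
proof -
  define P where "P = {(k, l). 1 \<le> k \<and> k < l \<and> l \<le> n + 1}"
  have C_eq: "C = (\<lambda>f.
        A * (\<Sum>j = 1..n + 1. f (\<tau> *\<^sub>R a_vec e j) + f (- \<tau> *\<^sub>R a_vec e j))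
      + B * (\<Sum>(k, l) \<in> P. f (\<tau> *\<^sub>R b_vec e k l) + f (- \<tau> *\<^sub>R b_vec e k l)) + c * f 0)"
    unfolding C_def n_def P_def simplex_rule_def ..
  have finP: "finite P"
    unfolding P_def by (rule finite_subset[of _ "{1..n + 1} \<times> {1..n + 1}"]) auto
  have rcardP: "real (card P) = (real n + 1) * real n / 2"
    using sum_pairs[of "\<lambda>_ _. 1" "n + 1"] by (simp add: P_def algebra_simps)
  then have "real (2 * card P) = real ((n + 1) * n)" by (simp add: algebra_simps)
  then have cardP: "2 * card P = (n + 1) * n" unfolding of_nat_eq_iff .
  let ?a = "\<lambda>f. (\<Sum>j\<in>{1..n + 1}. A * f (\<tau> *\<^sub>R a_vec e j)) + (\<Sum>j\<in>{1..n + 1}. A * f (- \<tau> *\<^sub>R a_vec e j))"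
  let ?b = "\<lambda>f. (\<Sum>p\<in>P. B * f (\<tau> *\<^sub>R b_vec e (fst p) (snd p)))
    + (\<Sum>p\<in>P. B * f (- \<tau> *\<^sub>R b_vec e (fst p) (snd p))) + (\<Sum>p\<in>{0 :: nat}. c * f 0)"
  have Cab: "C = (\<lambda>f. ?a f + ?b f)"
    unfolding C_eq by (simp add: sum.distrib distrib_left sum_distrib_left case_prod_beta fun_eq_iff)
  have "cubature_formula (card {1..n + 1} + card {1..n + 1}) ?a"
    by (intro cubature_formula_add cubature_formula_sum) auto
  then have a: "cubature_formula (2 * (n + 1)) ?a" by (simp only: card_atLeastAtMost) (simp add: mult_2)
  have "cubature_formula (card P + card P + card {0 :: nat}) ?b"
    using finP by (intro cubature_formula_add cubature_formula_sum) auto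
  moreover have "card P + card P + card {0 :: nat} = n\<^sup>2 + n + 1"
    using cardP by (simp add: power2_eq_square)
  ultimately have b: "cubature_formula (n\<^sup>2 + n + 1) ?b" by (simp only:)
  have "2 * (n + 1) + (n\<^sup>2 + n + 1) = n\<^sup>2 + 3 * n + 3" by simp
  then show "cubature_formula (n\<^sup>2 + 3 * n + 3) C"
    using cubature_formula_add[OF a b] unfolding Cab by (simp only:)
  show "cubature_formula (n\<^sup>2 + n + 1) C" if "A = 0"
    using b that unfolding Cab by simp
  show "C f = 0" if f: "\<And>x. f (- x) = - f x" for f
  proof -
    have "f 0 = 0" using f[of 0] by simp
    moreover have "f (\<tau> *\<^sub>R x) + f (- \<tau> *\<^sub>R x) = 0" for x using f[of "\<tau> *\<^sub>R x"] by simp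
    ultimately show ?thesis unfolding C_eq by simp
  qed
  have "real (card P) * (B * 2) = B * ((real n + 1) * real n)" by (simp add: rcardP)
  then show "C (\<lambda>x. 1) = 2 * (real n + 1) * (A + B * real n / 2) + c"
    unfolding C_eq by (simp add: field_simps)

  define \<beta> where "\<beta> = sqrt (real n / (2 * (real n - 1)))"
  have bv: "b_vec e k l $ i = \<beta> * (a_vec e k $ i + a_vec e l $ i)" for k l i
    by (simp add: b_vec_def \<beta>_def n_def)
  {
    assume e: "bij_betw e {1..n} UNIV" and n2: "2 \<le> n"
    have \<beta>2: "\<beta>\<^sup>2 = real n / (2 * (real n - 1))" using n2 by (simp add: \<beta>_def)
    have z: "(\<Sum>r=1..n+1. a_vec e r $ i) = 0" for i
      unfolding n_def by (rule sum_a_vec[OF e[unfolded n_def]])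
    have m: "(\<Sum>r=1..n+1. a_vec e r $ i * a_vec e r $ j) = of_bool (i = j) * ((real n + 1) / real n)" for i j
      unfolding n_def using sum_a_vec_mult[OF e[unfolded n_def], of i j] by simp
    show "C (\<lambda>x. x $ i * x $ j)
      = 2 * \<tau>\<^sup>2 * (A + B * real n / 2) * (real n + 1) / real n * of_bool (i = j)"
    proof -
      have "C (\<lambda>x. x $ i * x $ j) = A * (2 * \<tau>\<^sup>2 * (\<Sum>r=1..n+1. a_vec e r $ i * a_vec e r $ j))
        + B * (2 * \<tau>\<^sup>2 * \<beta>\<^sup>2 * (\<Sum>(k, l)\<in>P. (a_vec e k $ i + a_vec e l $ i) * (a_vec e k $ j + a_vec e l $ j)))"
        unfolding C_eq by (simp add: bv sum_distrib_left case_prod_beta power2_eq_square algebra_simps)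
      also have "\<dots> = A * (2 * \<tau>\<^sup>2 * (of_bool (i = j) * ((real n + 1) / real n)))
        + B * (2 * \<tau>\<^sup>2 * \<beta>\<^sup>2 * ((real (n + 1) - 2) * (of_bool (i = j) * ((real n + 1) / real n))))"
        unfolding P_def sum_pairs_second[OF z z] m ..
      also have "\<dots> = 2 * \<tau>\<^sup>2 * (A + B * real n / 2) * (real n + 1) / real n * of_bool (i = j)"
        unfolding \<beta>2 using n2 by (simp add: field_simps)
      finally show ?thesis .
    qed
    assume AB: "A + B * (real n)\<^sup>2 / (4 * (real n - 1)\<^sup>2) * (real n - 7) = 0"
    let ?Q = "\<Sum>r=1..n+1. a_vec e r $ i * a_vec e r $ j * a_vec e r $ k * a_vec e r $ l"
    let ?\<delta> = "of_bool (i = j \<and> k = l) + of_bool (i = k \<and> j = l) + of_bool (i = l \<and> j = k) :: real"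
    have \<beta>4: "\<beta> ^ 4 = (real n)\<^sup>2 / (4 * (real n - 1)\<^sup>2)"
    proof -
      have "\<beta> ^ 4 = (\<beta>\<^sup>2)\<^sup>2" by simp
      also have "\<dots> = (real n)\<^sup>2 / (2 * (real n - 1))\<^sup>2" unfolding \<beta>2 by (rule power_divide)
      also have "(2 * (real n - 1))\<^sup>2 = 4 * (real n - 1)\<^sup>2" unfolding power_mult_distrib by simp
      finally show ?thesis .
    qed
    have "C (\<lambda>x. x $ i * x $ j * x $ k * x $ l) = A * (2 * \<tau> ^ 4 * ?Q)
      + B * (2 * \<tau> ^ 4 * \<beta> ^ 4 * (\<Sum>(q, r)\<in>P. (a_vec e q $ i + a_vec e r $ i) * (a_vec e q $ j + a_vec e r $ j)
        * (a_vec e q $ k + a_vec e r $ k) * (a_vec e q $ l + a_vec e r $ l)))"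
    proof -
      have 1: "(\<tau> *\<^sub>R a) $ i * (\<tau> *\<^sub>R a) $ j * (\<tau> *\<^sub>R a) $ k * (\<tau> *\<^sub>R a) $ l
        + (- \<tau> *\<^sub>R a) $ i * (- \<tau> *\<^sub>R a) $ j * (- \<tau> *\<^sub>R a) $ k * (- \<tau> *\<^sub>R a) $ l
        = 2 * \<tau> ^ 4 * (a $ i * a $ j * a $ k * a $ l)" for a :: "real ^ 'n"
        by (simp add: power4_eq_xxxx)
      have 2: "b_vec e q r $ i * b_vec e q r $ j * b_vec e q r $ k * b_vec e q r $ l
        = \<beta> ^ 4 * ((a_vec e q $ i + a_vec e r $ i) * (a_vec e q $ j + a_vec e r $ j)
        * (a_vec e q $ k + a_vec e r $ k) * (a_vec e q $ l + a_vec e r $ l))" for q r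
        unfolding bv power4_eq_xxxx by (simp only: ac_simps)
      show ?thesis
        unfolding C_eq 1 2
        by (simp only: sum_distrib_left case_prod_beta mult.assoc) (simp add: zero_index)
    qed
    also have "\<dots> = A * (2 * \<tau> ^ 4 * ?Q)
      + B * (2 * \<tau> ^ 4 * \<beta> ^ 4 * ((real (n + 1) - 8) * ?Q + ((real n + 1) / real n)\<^sup>2 * ?\<delta>))"
      unfolding P_def sum_pairs_fourth[OF z z z z] m
      by (simp add: of_bool_conj power2_eq_square algebra_simps)
    also have "\<dots> = 2 * \<tau> ^ 4 * ?Q * (A + B * \<beta> ^ 4 * (real n - 7))
      + 2 * \<tau> ^ 4 * B * (\<beta> ^ 4 * ((real n + 1) / real n)\<^sup>2) * ?\<delta>"
      by (simp add: algebra_simps)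
    also have "A + B * \<beta> ^ 4 * (real n - 7) = 0" using AB by (simp add: \<beta>4)
    also have "\<beta> ^ 4 * ((real n + 1) / real n)\<^sup>2 = (real n + 1)\<^sup>2 / (4 * (real n - 1)\<^sup>2)"
      using n2 by (simp add: \<beta>4 power_divide)
    finally show "C (\<lambda>x. x $ i * x $ j * x $ k * x $ l)
      = \<tau> ^ 4 * B * (real n + 1)\<^sup>2 / (2 * (real n - 1)\<^sup>2) * ?\<delta>"
      by simp
  }
qed

section \<open>Functionals with spherical moments\<close>

lemma cubature_formula_linear:
  assumes "cubature_formula N C"
  shows "C (\<lambda>x. \<Sum>\<alpha>\<in>I. c \<alpha> * f \<alpha> x) = (\<Sum>\<alpha>\<in>I. c \<alpha> * C (f \<alpha>))"
proof -
  obtain w x where C: "\<And>f. C f = (\<Sum>j=1..N. w j * f (x j))"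
    using assms unfolding cubature_formula_def by auto
  have "C (\<lambda>x. \<Sum>\<alpha>\<in>I. c \<alpha> * f \<alpha> x) = (\<Sum>j=1..N. \<Sum>\<alpha>\<in>I. c \<alpha> * (w j * f \<alpha> (x j)))"
    unfolding C by (simp add: sum_distrib_left ac_simps)
  also have "\<dots> = (\<Sum>\<alpha>\<in>I. \<Sum>j=1..N. c \<alpha> * (w j * f \<alpha> (x j)))"
    by (rule sum.swap)
  finally show ?thesis unfolding C by (simp add: sum_distrib_left)
qed

lemma sum_mult_of_bool_eq:
  fixes f :: "'a::finite \<Rightarrow> 'b::semiring_1"
  shows "(\<Sum>j\<in>UNIV. f j * of_bool (i = j)) = f i" "(\<Sum>j\<in>UNIV. f j * of_bool (j = i)) = f i"
  by (simp_all add: of_bool_def if_distrib[where f = "(*) _"] cong: if_cong)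

text \<open>
  What the argument needs to know about the functional: on polynomials of degree at most five it has
  the moments of a spherically symmetric one. The strict inequality at the end is the
  Cauchy-Schwarz inequality for \<open>1\<close> and \<open>(norm x)\<^sup>2\<close>.
\<close>

locale spherical_moments =
  fixes L :: "(real ^ 'n::finite \<Rightarrow> real) \<Rightarrow> real" and s t :: real
  assumes one: "L (\<lambda>x. 1) = 1"
    and add: "f \<in> poly_funs 5 \<Longrightarrow> g \<in> poly_funs 5 \<Longrightarrow> L (\<lambda>x. f x + g x) = L f + L g"
    and cmult: "f \<in> poly_funs 5 \<Longrightarrow> L (\<lambda>x. c * f x) = c * L f"
    and odd: "f \<in> poly_funs 5 \<Longrightarrow> (\<And>x. f (- x) = - f x) \<Longrightarrow> L f = 0"
    and second: "L (\<lambda>x. x $ i * x $ j) = s * of_bool (i = j)"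
    and fourth: "L (\<lambda>x. x $ i * x $ j * x $ k * x $ l) =
      t * (of_bool (i = j \<and> k = l) + of_bool (i = k \<and> j = l) + of_bool (i = l \<and> j = k))"
    and s_pos: "s > 0" and t_pos: "t > 0"
    and st: "real CARD('n) * s\<^sup>2 < (real CARD('n) + 2) * t"
begin

lemma sum_sum:
  assumes "\<And>i. i \<in> I \<Longrightarrow> f i \<in> poly_funs 5"
  shows "L (\<lambda>x. \<Sum>i\<in>I. f i x) = (\<Sum>i\<in>I. L (f i))"
  using assms
proof (induction I rule: infinite_finite_induct)
  case (insert i I)
  then show ?case
    using add[of "f i" "\<lambda>x. \<Sum>i\<in>I. f i x"] poly_funs_sum[of I f 5] by simp
qed (use cmult[OF poly_funs_const, of 0] in auto)

text \<open>
  Testing \<open>G\<close> against all \<open>x\<^sub>k x\<^sub>l\<close> and against \<open>1\<close> gives a linear system: it forces the off-diagonal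
  entries to vanish and expresses the diagonal entries and the constant through the trace. The
  trace is multiplied by \<open>(n + 2) t - n s\<^sup>2 > 0\<close> and must vanish too.
\<close>

lemma nondegenerate:
  assumes G: "G \<in> sym_space"
    and orth: "\<And>g. g \<in> poly_funs 2 \<Longrightarrow> L (\<lambda>x. (G \<bullet> quad_vec x) * g x) = 0"
  shows "G = 0"
proof -
  define M where "M i j = fst G $ i $ j" for i j
  define c where "c = snd G"
  define tr where "tr = (\<Sum>i\<in>UNIV. M i i)"
  have sym: "M i j = M j i" for i j using G by (simp add: M_def sym_space_def)
  have q2: "(\<lambda>x. x $ i * x $ j) \<in> poly_funs 5" for i j :: 'n
    by (rule poly_funs_quadratic) simp
  have q4: "(\<lambda>x. x $ i * x $ j * x $ k * x $ l) \<in> poly_funs 5" for i j k l :: 'n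
    by (rule poly_funs_quartic) simp
  have eq0: "s * tr + c = 0"
  proof -
    have "0 = L (\<lambda>x. (G \<bullet> quad_vec x) * 1)" using orth[OF poly_funs_const[of 1]] by simp
    also have "\<dots> = L (\<lambda>x. (\<Sum>i\<in>UNIV. \<Sum>j\<in>UNIV. M i j * (x $ i * x $ j)) + c * 1)"
      by (simp add: inner_quad_vec M_def c_def)
    also have "\<dots> = (\<Sum>i\<in>UNIV. \<Sum>j\<in>UNIV. M i j * (s * of_bool (i = j))) + c * 1"
      by (simp only: add cmult sum_sum poly_funs_sum poly_funs_cmult poly_funs_const q2 second one)
    also have "(\<Sum>i\<in>UNIV. \<Sum>j\<in>UNIV. M i j * (s * of_bool (i = j))) = s * tr"
      by (simp only: mult.assoc[symmetric] sum_mult_of_bool_eq tr_def sum_distrib_right[symmetric])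
        (rule mult.commute)
    finally show ?thesis by simp
  qed
  have eq2: "2 * t * M k l + of_bool (k = l) * (t * tr + c * s) = 0" for k l
  proof -
    have "(\<lambda>x. x $ k * x $ l) \<in> poly_funs 2"
      by (rule poly_funs_quadratic) simp
    then have "0 = L (\<lambda>x. (G \<bullet> quad_vec x) * (x $ k * x $ l))" using orth by simp
    also have "\<dots> = L (\<lambda>x. (\<Sum>i\<in>UNIV. \<Sum>j\<in>UNIV. M i j * (x $ i * x $ j * x $ k * x $ l))
        + c * (x $ k * x $ l))"
      by (simp add: inner_quad_vec M_def c_def distrib_right sum_distrib_right mult.assoc)
    also have "\<dots> = (\<Sum>i\<in>UNIV. \<Sum>j\<in>UNIV. M i j *
        (t * (of_bool (i = j \<and> k = l) + of_bool (i = k \<and> j = l) + of_bool (i = l \<and> j = k))))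
        + c * (s * of_bool (k = l))"
      by (simp only: add cmult sum_sum poly_funs_sum poly_funs_cmult q2 q4 second fourth)
    also have "(\<Sum>i\<in>UNIV. \<Sum>j\<in>UNIV. M i j *
        (t * (of_bool (i = j \<and> k = l) + of_bool (i = k \<and> j = l) + of_bool (i = l \<and> j = k))))
      = t * (of_bool (k = l) * tr + M k l + M l k)"
    proof -
      have "(\<Sum>i\<in>UNIV. \<Sum>j\<in>UNIV. M i j * of_bool (i = j \<and> k = l)) = of_bool (k = l) * tr"
        by (cases "k = l") (simp_all add: tr_def sum_mult_of_bool_eq)
      moreover have "(\<Sum>i\<in>UNIV. \<Sum>j\<in>UNIV. M i j * of_bool (i = p \<and> j = q)) = M p q" for p q
        by (simp only: of_bool_conj mult.assoc[symmetric] sum_mult_of_bool_eq)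
      ultimately show ?thesis
        by (simp only: mult.left_commute[of _ t] sum_distrib_left[symmetric] distrib_left sum.distrib)
    qed
    finally show ?thesis using sym[of k l] by (simp add: algebra_simps)
  qed
  have off: "M k l = 0" if "k \<noteq> l" for k l
    using eq2[of k l] that t_pos by simp
  have "(\<Sum>k\<in>UNIV. 2 * t * M k k + (t * tr + c * s)) = 0"
    using eq2[of k k for k] by (intro sum.neutral) simp
  then have "2 * t * tr + real CARD('n) * (t * tr + c * s) = 0"
    by (simp add: sum.distrib tr_def flip: sum_distrib_left)
  moreover have "c = - (s * tr)" using eq0 by simp
  ultimately have "tr * ((real CARD('n) + 2) * t - real CARD('n) * s\<^sup>2) = 0"
    by (simp add: algebra_simps power2_eq_square)
  then have "tr = 0" using st by simp
  then have "c = 0" using eq0 by simp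
  have "M k l = 0" for k l
    using eq2[of k l] off[of k l] \<open>tr = 0\<close> \<open>c = 0\<close> t_pos by (cases "k = l") auto
  with \<open>c = 0\<close> show "G = 0"
    by (simp add: M_def c_def prod_eq_iff vec_eq_iff)
qed

lemma lower_bound: "cubature_of_degree L 5 N C \<Longrightarrow> CARD('n)\<^sup>2 + CARD('n) + 1 \<le> N"
  by (rule cubature_degree_five_lower_bound[OF odd nondegenerate])

lemma eq_on_poly_funs_5I:
  assumes C: "cubature_formula N C"
    and odd': "\<And>f. (\<And>x. f (- x) = - f x) \<Longrightarrow> C f = 0"
    and "C (\<lambda>x. 1) = 1"
    and "\<And>i j. C (\<lambda>x. x $ i * x $ j) = s * of_bool (i = j)"
    and "\<And>i j k l. C (\<lambda>x. x $ i * x $ j * x $ k * x $ l) =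
      t * (of_bool (i = j \<and> k = l) + of_bool (i = k \<and> j = l) + of_bool (i = l \<and> j = k))"
  shows "cubature_of_degree L 5 N C"
  unfolding cubature_of_degree_def
proof (intro conjI ballI)
  fix f :: "real ^ 'n \<Rightarrow> real" assume "f \<in> poly_funs 5"
  then obtain c where f: "f = (\<lambda>x. \<Sum>\<alpha> | sum \<alpha> UNIV \<le> 5. c \<alpha> * monomial_fun \<alpha> x)"
    unfolding poly_funs_def by auto
  have mono: "C (monomial_fun \<alpha>) = L (monomial_fun \<alpha>)" if \<alpha>: "sum \<alpha> UNIV \<le> 5" for \<alpha> :: "'n \<Rightarrow> nat"
  proof -
    obtain xs where xs: "length xs = sum \<alpha> UNIV" "monomial_fun \<alpha> = (\<lambda>x. \<Prod>i\<leftarrow>xs. x $ i)"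
      by (rule monomial_fun_eq_prod_list)
    show ?thesis
    proof (cases "even (length xs)")
      case False
      have neg: "(\<Prod>i\<leftarrow>ys. (- x) $ i) = (-1) ^ length ys * (\<Prod>i\<leftarrow>ys. x $ i)" for ys and x :: "real ^ 'n"
        by (induction ys) auto
      then have "monomial_fun \<alpha> (- x) = - monomial_fun \<alpha> x" for x
        unfolding xs(2) neg using False by simp
      then show ?thesis
        using odd odd' monomial_fun_in_poly_funs[OF \<alpha>] by metis
    next
      case True
      then have "length xs = 0 \<or> length xs = 2 \<or> length xs = 4"
        using \<alpha> xs(1) by presburger
      then consider "xs = []" | i j where "xs = [i, j]" | i j k l where "xs = [i, j, k, l]"
        by (auto simp: length_Suc_conv eval_nat_numeral)
      then show ?thesis
        by cases (simp_all add: xs(2) assms one second fourth mult.assoc[symmetric])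
    qed
  qed
  have "L f = (\<Sum>\<alpha> | sum \<alpha> UNIV \<le> 5. c \<alpha> * L (monomial_fun \<alpha>))"
    unfolding f by (subst sum_sum) (auto simp: cmult monomial_fun_in_poly_funs intro!: poly_funs_cmult)
  also have "\<dots> = C f"
    unfolding f cubature_formula_linear[OF C] by (intro sum.cong) (auto simp: mono)
  finally show "C f = L f" by simp
qed (rule C)

end

section \<open>Surface integrals and spherically symmetric functionals\<close>

lemma integral_scale_measure_of_nat:
  fixes f :: "'a \<Rightarrow> real"
  assumes f: "f \<in> borel_measurable M"
  shows "integral\<^sup>L (scale_measure (of_nat k) M) f = real k * integral\<^sup>L M f"
proof -
  have "scale_measure (of_nat k) M = density M (\<lambda>_. ennreal (real k))"
    by (rule measure_eqI)
      (simp_all add: emeasure_density nn_integral_cmult_indicator ennreal_of_nat_eq_real_of_nat)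
  then show ?thesis using f by (simp add: integral_density)
qed

text \<open>
  Homogeneity turns the surface integral into an integral over the ball against a radial weight, so
  that the fourth moments of the sphere are covered by the results on radial weights. At the origin
  the hypothesis means \<open>f 0 = 0\<close> if \<open>d > 0\<close>, as \<open>x / 0 = 0\<close>.
\<close>

lemma sphere_integral_homogeneous:
  fixes f :: "'a::euclidean_space \<Rightarrow> real"
  assumes f: "f \<in> borel_measurable borel" and hom: "\<And>x. f (sgn x) = f x / norm x ^ d"
  shows "sphere_integral f = (LINT x|lebesgue. f x * (real DIM('a) * indicator (ball 0 1) x / norm x ^ d))"
proof -
  have sgn: "sgn \<in> restrict_space lborel (ball (0 :: 'a) 1) \<rightarrow>\<^sub>M borel"
    by (intro measurable_restrict_space1) simp
  have [measurable]: "(\<lambda>x :: 'a. norm x ^ d) \<in> borel_measurable borel" "ball (0 :: 'a) 1 \<in> sets borel"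
    by (intro borel_measurable_continuous_onI continuous_intros) simp
  have meas: "(\<lambda>x. f x * (real DIM('a) * indicator (ball 0 1) x / norm x ^ d)) \<in> borel_measurable borel"
    using f by measurable
  have "sphere_integral f
      = real DIM('a) * (LINT x|distr (restrict_space lborel (ball (0 :: 'a) 1)) borel sgn. f x)"
    unfolding sphere_integral_def sphere_measure_def
    using f by (intro integral_scale_measure_of_nat) simp
  also have "(LINT x|distr (restrict_space lborel (ball (0 :: 'a) 1)) borel sgn. f x)
      = (LINT x|restrict_space lborel (ball 0 1). f (sgn x))"
    using sgn f by (rule integral_distr)
  also have "\<dots> = (LINT x|lborel. indicator (ball 0 1) x *\<^sub>R f (sgn x))"
    by (rule integral_restrict_space) simp
  also have "real DIM('a) * \<dots>
      = (LINT x|lborel. real DIM('a) * (indicator (ball 0 1) x *\<^sub>R f (sgn x)))" by simp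
  also have "\<dots> = (LINT x|lborel. f x * (real DIM('a) * indicator (ball 0 1) x / norm x ^ d))"
    by (intro Bochner_Integration.integral_cong refl) (simp add: hom)
  also have "\<dots> = (LINT x|lebesgue. f x * (real DIM('a) * indicator (ball 0 1) x / norm x ^ d))"
    using meas by (intro integral_completion[symmetric]) simp
  finally show ?thesis .
qed

lemma norm_power4_eq_sum:
  fixes x :: "real ^ 'n::finite"
  shows "norm x ^ 4 = (\<Sum>i\<in>UNIV. \<Sum>j\<in>UNIV. x $ i * x $ i * x $ j * x $ j)"
proof -
  have n2: "(norm x)\<^sup>2 = (\<Sum>i\<in>UNIV. x $ i * x $ i)"
    unfolding power2_norm_eq_inner by (simp add: inner_vec_def)
  have "norm x ^ 4 = (norm x)\<^sup>2 * (norm x)\<^sup>2" by (simp add: power4_eq_xxxx power2_eq_square)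
  then show ?thesis unfolding n2 sum_product by (simp add: mult.assoc)
qed

lemma (in radial_moments) norm_fourth_moment:
  assumes int: "\<And>i j k l. integrable lebesgue (\<lambda>x. (x $ i * x $ j * x $ k * x $ l) * \<phi> x)"
    and ab: "a \<noteq> b"
  shows "M (\<lambda>x. norm x ^ 4) = real CARD('n) * (real CARD('n) + 2) * M (\<lambda>x. (x $ a)\<^sup>2 * (x $ b)\<^sup>2)"
proof -
  let ?t = "M (\<lambda>x. (x $ a)\<^sup>2 * (x $ b)\<^sup>2)"
  have "M (\<lambda>x. norm x ^ 4) = (\<Sum>i\<in>UNIV. \<Sum>j\<in>UNIV. M (\<lambda>x. x $ i * x $ i * x $ j * x $ j))"
    unfolding M_def norm_power4_eq_sum sum_distrib_right
    using int by (simp add: Bochner_Integration.integral_sum Bochner_Integration.integrable_sum)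
  also have "\<dots> = (\<Sum>i\<in>(UNIV :: 'n set). \<Sum>j\<in>UNIV. ?t + 2 * ?t * of_bool (i = j))"
    unfolding fourth_moment[OF int ab] by (intro sum.cong refl) auto
  also have "\<dots> = real CARD('n) * (real CARD('n) + 2) * ?t"
    by (simp only: sum.distrib sum_mult_of_bool_eq) (simp add: algebra_simps)
  finally show ?thesis .
qed

text \<open>
  Summing all moments of \<open>x\<^sub>i\<^sup>2 x\<^sub>j\<^sup>2\<close> gives the integral of \<open>(norm x) ^ 4\<close>, which on the sphere is the
  surface area; so no integral other than the volume of the ball has to be computed.
\<close>

lemma sphere_integral_fourth:
  fixes a b :: "'n::finite"
  assumes ab: "a \<noteq> b"
  shows "real CARD('n) * (real CARD('n) + 2) * sphere_integral (\<lambda>x :: real ^ 'n. (x $ a)\<^sup>2 * (x $ b)\<^sup>2)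
    = 2 * pi powr (real CARD('n) / 2) / Gamma (real CARD('n) / 2)"
proof -
  let ?n = "real CARD('n)"
  define \<phi> :: "real ^ 'n \<Rightarrow> real" where "\<phi> x = ?n * indicator (ball 0 1) x / norm x ^ 4" for x
  have coord[measurable]: "(\<lambda>x :: real ^ 'n. x $ i) \<in> borel_measurable borel" for i
    by (intro borel_measurable_continuous_onI continuous_intros)
  have [measurable]: "(\<lambda>x :: real ^ 'n. norm x ^ 4) \<in> borel_measurable borel"
    "ball (0 :: real ^ 'n) 1 \<in> sets borel"
    by (intro borel_measurable_continuous_onI continuous_intros) simp
  have card: "CARD('n) \<ge> 2"
    using card_mono[of UNIV "{a, b}"] ab by simp
  interpret radial_moments \<phi> "\<lambda>f. LINT x|lebesgue. f x * \<phi> x"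
    by unfold_locales (use card in \<open>auto simp: radial_def \<phi>_def indicator_def\<close>)
  have ball: "integrable lborel (\<lambda>x :: real ^ 'n. ?n * indicator (ball 0 1) x)"
    by (intro integrable_mult_right integrable_real_indicator)
      (use emeasure_bounded_finite[of "ball (0 :: real ^ 'n) 1"] in auto)
  have int: "integrable lebesgue (\<lambda>x. (x $ i * x $ j * x $ k * x $ l) * \<phi> x)" for i j k l
  proof -
    have meas: "(\<lambda>x. (x $ i * x $ j * x $ k * x $ l) * \<phi> x) \<in> borel_measurable lborel"
      unfolding \<phi>_def using coord by measurable
    have "integrable lborel (\<lambda>x. (x $ i * x $ j * x $ k * x $ l) * \<phi> x)"
    proof (rule Bochner_Integration.integrable_bound[OF ball meas], rule AE_I2)
      fix x :: "real ^ 'n"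
      have "\<bar>x $ i * x $ j * x $ k * x $ l\<bar> \<le> norm x * norm x * norm x * norm x"
        unfolding abs_mult by (intro mult_mono component_le_norm_cart) auto
      then have "\<bar>x $ i * x $ j * x $ k * x $ l\<bar> / norm x ^ 4 \<le> 1"
        by (cases "x = 0") (simp_all add: power4_eq_xxxx divide_le_eq)
      then have "?n * indicator (ball 0 1) x * (\<bar>x $ i * x $ j * x $ k * x $ l\<bar> / norm x ^ 4)
          \<le> ?n * indicator (ball 0 1) x * 1"
        by (intro mult_left_mono) auto
      then show "norm ((x $ i * x $ j * x $ k * x $ l) * \<phi> x) \<le> norm (?n * indicator (ball 0 1) x)"
        by (simp add: \<phi>_def abs_mult mult_ac)
    qed
    then show ?thesis using meas by (simp add: integrable_completion)
  qed
  have "sphere_integral (\<lambda>x :: real ^ 'n. (x $ a)\<^sup>2 * (x $ b)\<^sup>2)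
      = (LINT x|lebesgue. ((x $ a)\<^sup>2 * (x $ b)\<^sup>2) * \<phi> x)"
  proof -
    have "(\<lambda>x :: real ^ 'n. (x $ a)\<^sup>2 * (x $ b)\<^sup>2) \<in> borel_measurable borel"
      using coord by measurable
    moreover have "((sgn x) $ a)\<^sup>2 * ((sgn x) $ b)\<^sup>2 = (x $ a)\<^sup>2 * (x $ b)\<^sup>2 / norm x ^ 4" for x :: "real ^ 'n"
      by (simp add: sgn_div_norm power_divide power4_eq_xxxx power2_eq_square divide_simps)
    ultimately show ?thesis
      using sphere_integral_homogeneous[of "\<lambda>x :: real ^ 'n. (x $ a)\<^sup>2 * (x $ b)\<^sup>2" 4]
      by (simp add: \<phi>_def)
  qed
  then have "?n * (?n + 2) * sphere_integral (\<lambda>x :: real ^ 'n. (x $ a)\<^sup>2 * (x $ b)\<^sup>2)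
      = (LINT x|lebesgue. norm x ^ 4 * \<phi> x)"
    using norm_fourth_moment[OF int ab] by simp
  also have "\<dots> = (LINT x|lborel. norm x ^ 4 * \<phi> x)"
    unfolding \<phi>_def by (intro integral_completion) measurable
  also have "\<dots> = (LINT x|lborel. ?n * indicator (ball (0 :: real ^ 'n) 1) x)"
  proof (rule integral_cong_AE)
    have "AE x in lborel. x \<noteq> (0 :: real ^ 'n)" by (rule AE_lborel_singleton)
    then show "AE x in lborel. norm x ^ 4 * \<phi> x = ?n * indicator (ball (0 :: real ^ 'n) 1) x"
      by eventually_elim (simp add: \<phi>_def)
  qed (unfold \<phi>_def, measurable)
  also have "\<dots> = ?n * measure lborel (ball (0 :: real ^ 'n) 1)"
    by simp
  also have "\<dots> = ?n * (pi powr (?n / 2) / Gamma (?n / 2 + 1))"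
    by (simp add: content_ball unit_ball_vol_def)
  also have "Gamma (?n / 2 + 1) = ?n / 2 * Gamma (?n / 2)"
    using card by (intro Gamma_plus1) (auto elim!: nonpos_Ints_cases)
  finally show ?thesis using card by simp
qed

lemma integral_weight_pos:
  fixes f \<phi> :: "'a::euclidean_space \<Rightarrow> real"
  assumes int: "integrable lebesgue (\<lambda>x. f x * \<phi> x)"
    and nonneg: "\<And>x. 0 \<le> f x" "\<And>x. 0 \<le> \<phi> x"
    and zeros: "negligible {x. f x = 0}" and nz: "(LINT x|lebesgue. \<phi> x) \<noteq> 0"
  shows "0 < (LINT x|lebesgue. f x * \<phi> x)"
proof (rule ccontr)
  assume "\<not> ?thesis"
  moreover have "0 \<le> (LINT x|lebesgue. f x * \<phi> x)" using nonneg by simp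
  ultimately have "(LINT x|lebesgue. f x * \<phi> x) = 0" by simp
  then have "AE x in lebesgue. f x * \<phi> x = 0"
    using integral_nonneg_eq_0_iff_AE[OF int] nonneg by simp
  moreover have "AE x in lebesgue. x \<notin> {x. f x = 0}"
    using zeros by (intro AE_not_in) (simp add: negligible_iff_null_sets)
  ultimately have "AE x in lebesgue. \<phi> x = 0" by eventually_elim auto
  then have "(LINT x|lebesgue. \<phi> x) = 0" by (rule integral_eq_zero_AE)
  with nz show False by simp
qed

lemma spherical_moments_radial:
  fixes \<phi> :: "real ^ 'n::finite \<Rightarrow> real" and a b :: 'n
  defines "L \<equiv> \<lambda>f. LINT x|lebesgue. f x * \<phi> x"
  assumes radial: "radial \<phi>" and nonneg: "\<And>x. 0 \<le> \<phi> x"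
    and int: "\<And>f. f \<in> poly_funs 5 \<Longrightarrow> integrable lebesgue (\<lambda>x. f x * \<phi> x)"
    and one: "L (\<lambda>x. 1) = 1" and ab: "a \<noteq> b"
  shows "spherical_moments L (L (\<lambda>x. (x $ a)\<^sup>2)) (L (\<lambda>x. (x $ a)\<^sup>2 * (x $ b)\<^sup>2))"
proof -
  let ?n = "real CARD('n)"
  define s where "s = L (\<lambda>x. (x $ a)\<^sup>2)"
  define t where "t = L (\<lambda>x. (x $ a)\<^sup>2 * (x $ b)\<^sup>2)"
  have card: "CARD('n) \<ge> 2"
    using card_mono[of UNIV "{a, b}"] ab by simp
  interpret radial_moments \<phi> L
    unfolding L_def by unfold_locales (use card radial in auto)
  have q2: "(\<lambda>x. x $ i * x $ j) \<in> poly_funs 5" for i j :: 'n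
    by (rule poly_funs_quadratic) simp
  have q4: "(\<lambda>x. x $ i * x $ j * x $ k * x $ l) \<in> poly_funs 5" for i j k l :: 'n
    by (rule poly_funs_quartic) simp
  have add: "L (\<lambda>x. f x + g x) = L f + L g" if "f \<in> poly_funs 5" "g \<in> poly_funs 5" for f g
    unfolding L_def distrib_right using that int by (intro Bochner_Integration.integral_add) auto
  have cmult: "L (\<lambda>x. c * f x) = c * L f" if "f \<in> poly_funs 5" for c f
    unfolding L_def mult.assoc using that int by simp
  have second: "L (\<lambda>x. x $ i * x $ j) = s * of_bool (i = j)" for i j
    using second_moment[OF int[OF q2], of i j a] by (simp add: s_def)
  have pos: "0 < L f" if "f \<in> poly_funs 5" "\<And>x. 0 \<le> f x" "negligible {x. f x = 0}" for f
    unfolding L_def using that int nonneg one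
    by (intro integral_weight_pos) (auto simp: L_def)
  have coord_zero: "negligible {x :: real ^ 'n. x $ i = 0}" for i
    using negligible_standard_hyperplane_cart by blast
  have s_pos: "s > 0"
  proof -
    have "0 < L (\<lambda>x. x $ a * x $ a)" using coord_zero[of a] by (intro pos q2) auto
    then show ?thesis by (simp add: second)
  qed
  have t_pos: "t > 0"
  proof -
    have "0 < L (\<lambda>x. x $ a * x $ a * x $ b * x $ b)"
    proof (intro pos q4)
      have "{x :: real ^ 'n. x $ a * x $ a * x $ b * x $ b = 0} = {x. x $ a = 0} \<union> {x. x $ b = 0}"
        by auto
      then show "negligible {x :: real ^ 'n. x $ a * x $ a * x $ b * x $ b = 0}"
        using coord_zero by simp
      show "0 \<le> x $ a * x $ a * x $ b * x $ b" for x :: "real ^ 'n"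
        using zero_le_power2[of "x $ a * x $ b"] by (simp only: power2_eq_square ac_simps)
    qed
    then show ?thesis by (simp add: t_def power2_eq_square mult.assoc)
  qed
  \<comment> \<open>Strictness in the Cauchy-Schwarz inequality for \<open>1\<close> and \<open>\<parallel>x\<parallel>\<^sup>2\<close>: the weight is not concentrated on a sphere.\<close>
  have st: "?n * s\<^sup>2 < (?n + 2) * t"
  proof -
    have p2: "(\<lambda>x :: real ^ 'n. (norm x)\<^sup>2) \<in> poly_funs 5" and L2: "L (\<lambda>x. (norm x)\<^sup>2) = ?n * s"
    proof -
      have n2: "(\<lambda>x :: real ^ 'n. (norm x)\<^sup>2) = (\<lambda>x. \<Sum>i\<in>UNIV. x $ i * x $ i)"
        by (simp add: power2_norm_eq_inner inner_vec_def)
      show "(\<lambda>x :: real ^ 'n. (norm x)\<^sup>2) \<in> poly_funs 5"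
        unfolding n2 by (intro poly_funs_sum q2)
      have "L (\<lambda>x. (norm x)\<^sup>2) = (\<Sum>i\<in>UNIV. L (\<lambda>x. x $ i * x $ i))"
        unfolding n2 L_def sum_distrib_right using int[OF q2]
        by (intro Bochner_Integration.integral_sum) auto
      then show "L (\<lambda>x. (norm x)\<^sup>2) = ?n * s" by (simp add: second)
    qed
    have p4: "(\<lambda>x :: real ^ 'n. norm x ^ 4) \<in> poly_funs 5"
      unfolding norm_power4_eq_sum by (intro poly_funs_sum q4)
    have eq: "(\<lambda>x :: real ^ 'n. ((norm x)\<^sup>2 - ?n * s)\<^sup>2)
        = (\<lambda>x. (norm x ^ 4 + (- 2 * ?n * s) * (norm x)\<^sup>2) + (?n * s)\<^sup>2 * 1)"
      by (simp add: fun_eq_iff power2_diff algebra_simps)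
    have p: "(\<lambda>x :: real ^ 'n. ((norm x)\<^sup>2 - ?n * s)\<^sup>2) \<in> poly_funs 5"
      unfolding eq by (intro poly_funs_add poly_funs_cmult poly_funs_const p2 p4)
    have "negligible {x :: real ^ 'n. ((norm x)\<^sup>2 - ?n * s)\<^sup>2 = 0}"
    proof (rule negligible_subset[OF negligible_sphere])
      show "{x :: real ^ 'n. ((norm x)\<^sup>2 - ?n * s)\<^sup>2 = 0} \<subseteq> sphere 0 (sqrt (?n * s))"
        by (auto simp: real_sqrt_unique)
    qed
    then have "0 < L (\<lambda>x. ((norm x)\<^sup>2 - ?n * s)\<^sup>2)"
      by (intro pos p) simp_all
    also have "\<dots> = ?n * (?n + 2) * t - 2 * ?n * s * (?n * s) + (?n * s)\<^sup>2"
      unfolding eq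
      by (simp only: add cmult poly_funs_add poly_funs_cmult poly_funs_const p2 p4 L2 one
          norm_fourth_moment[OF int[OF q4] ab] t_def)
    also have "\<dots> = ?n * ((?n + 2) * t - ?n * s\<^sup>2)"
      by (simp add: power2_eq_square algebra_simps)
    finally show ?thesis by (simp add: zero_less_mult_iff)
  qed
  have "spherical_moments L s t"
    by (unfold_locales; (fact one add cmult second s_pos t_pos st)?)
      (auto simp: t_def fourth_moment[OF int[OF q4] ab] intro: odd_eq_0 int)
  then show ?thesis by (simp add: s_def t_def)
qed

section \<open>The cubature formula\<close>

theorem mainTheorem4:
  fixes e :: "nat \<Rightarrow> 'n::finite"
    and n :: nat
    and p :: real and q :: ereal
    and \<Omega> :: "(real ^ 'n) set"
    and \<rho> :: "real ^ 'n \<Rightarrow> real"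
    and L C :: "(real ^ 'n \<Rightarrow> real) \<Rightarrow> real"
    and V \<gamma> \<tau> A B :: real
  assumes n: "n = CARD('n)" "n \<ge> 4"
    and e: "bij_betw e {1..n} (UNIV :: 'n set)"
    and region: "0 \<le> p" "ereal p < q" "\<Omega> = shell p q"
    and weight: "\<forall>x\<in>\<Omega>. \<rho> x \<ge> 0" "\<exists>w :: real \<Rightarrow> real. \<forall>x\<in>\<Omega>. \<rho> x = w (norm x)"
    and moments: "\<forall>f\<in>poly_funs 5. set_integrable lebesgue \<Omega> (\<lambda>x. f x * \<rho> x)"
    and L: "L = weighted_integral \<Omega> \<rho>"
    and normalized: "L (\<lambda>x. 1) = 1"
    and V: "V = 2 * pi powr (real n / 2) / Gamma (real n / 2)"
    and \<gamma>: "\<gamma> = (L (\<lambda>x. (x $ e 1)\<^sup>2))\<^sup>2 / L (\<lambda>x. (x $ e 1)\<^sup>2 * (x $ e 2)\<^sup>2)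
                 * (2 * Gamma (real n / 2 + 2) / (pi powr (real n / 2) * (real n + 2)\<^sup>2))"
    and \<tau>: "\<tau> = root 4 (L (\<lambda>x. (x $ e 1)\<^sup>2 * (x $ e 2)\<^sup>2)
                 / (\<gamma> * sphere_integral (\<lambda>x :: real ^ 'n. (x $ e 1)\<^sup>2 * (x $ e 2)\<^sup>2)))"
    and A: "A = \<gamma> * (real n * (7 - real n) * V / (2 * (real n + 1)\<^sup>2 * (real n + 2)))"
    and B: "B = \<gamma> * (2 * (real n - 1)\<^sup>2 * V / (real n * (real n + 1)\<^sup>2 * (real n + 2)))"
    and C: "C = (\<lambda>f.
        A * (\<Sum>j = 1..n + 1. f (\<tau> *\<^sub>R a_vec e j) + f (- \<tau> *\<^sub>R a_vec e j))
      + B * (\<Sum>(k, l) \<in> {(k, l). 1 \<le> k \<and> k < l \<and> l \<le> n + 1}.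
               f (\<tau> *\<^sub>R b_vec e k l) + f (- \<tau> *\<^sub>R b_vec e k l))
      + (1 - \<gamma> * V) * f 0)"
  shows "(\<exists>N \<le> n\<^sup>2 + 3 * n + 3. cubature_of_degree L 5 N C)
       \<and> (n = 7 \<longrightarrow> A = 0 \<and> minimal_cubature_of_degree L 5 (n\<^sup>2 + n + 1) C)"
proof -
  define \<phi> where "\<phi> x = indicator \<Omega> x * \<rho> x" for x
  have L\<phi>: "L = (\<lambda>f. LINT x|lebesgue. f x * \<phi> x)"
    unfolding L weighted_integral_def set_lebesgue_integral_def \<phi>_def by (simp add: mult_ac)
  have ab: "e 1 \<noteq> e 2"
    using inj_onD[OF bij_betw_imp_inj_on[OF e], of 1 2] n(2) by auto
  obtain w :: "real \<Rightarrow> real" where w: "\<forall>x\<in>\<Omega>. \<rho> x = w (norm x)" using weight(2) by blast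
  have radial: "radial \<phi>"
    unfolding radial_def
  proof (intro allI impI)
    fix x y :: "real ^ 'n" assume "norm x = norm y"
    then show "\<phi> x = \<phi> y" using w by (auto simp: \<phi>_def indicator_def region(3) shell_def)
  qed
  have nonneg: "0 \<le> \<phi> x" for x using weight(1) by (auto simp: \<phi>_def indicator_def)
  have int: "integrable lebesgue (\<lambda>x. f x * \<phi> x)" if "f \<in> poly_funs 5" for f
    using bspec[OF moments that] unfolding set_integrable_def \<phi>_def by (simp add: mult_ac)
  define s where "s = L (\<lambda>x. (x $ e 1)\<^sup>2)"
  define t where "t = L (\<lambda>x. (x $ e 1)\<^sup>2 * (x $ e 2)\<^sup>2)"
  define S where "S = sphere_integral (\<lambda>x :: real ^ 'n. (x $ e 1)\<^sup>2 * (x $ e 2)\<^sup>2)"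
  interpret spherical_moments L s t
    using spherical_moments_radial[OF radial nonneg int normalized[unfolded L\<phi>] ab]
    unfolding s_def t_def L\<phi> .
  have n4: "real n \<ge> 4" using n(2) by simp
  have S: "real n * (real n + 2) * S = V"
    using sphere_integral_fourth[OF ab] unfolding S_def V n(1) .
  have G_pos: "Gamma (real n / 2) > 0" using n4 by (intro Gamma_real_pos) simp
  have V_pos: "V > 0" unfolding V using G_pos by simp
  have gamma_V: "\<gamma> * V = s\<^sup>2 * real n / (t * (real n + 2))"
  proof -
    have Gamma2: "Gamma (real n / 2 + 2) = (real n / 2 + 1) * (real n / 2 * Gamma (real n / 2))"
    proof -
      have "Gamma (real n / 2 + 1 + 1) = (real n / 2 + 1) * Gamma (real n / 2 + 1)"
        using n4 by (intro Gamma_plus1) (auto elim!: nonpos_Ints_cases)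
      moreover have "Gamma (real n / 2 + 1) = real n / 2 * Gamma (real n / 2)"
        using n4 by (intro Gamma_plus1) (auto elim!: nonpos_Ints_cases)
      ultimately show ?thesis by (simp add: add.commute)
    qed
    have cancel: "s\<^sup>2 / t * (2 * ((m / 2 + 1) * (m / 2 * g)) / (P * (m + 2)\<^sup>2)) * (2 * P / g)
        = s\<^sup>2 * m / (t * (m + 2))" if "g > 0" "P > 0" "m > 0" for g P m :: real
    proof -
      have "2 * ((m / 2 + 1) * (m / 2 * g)) = m * (m + 2) * g / 2" by (simp add: field_simps)
      then show ?thesis
        using that t_pos by (simp only:) (simp add: divide_simps power2_eq_square)
    qed
    show ?thesis
      unfolding \<gamma> V s_def[symmetric] t_def[symmetric] Gamma2
      by (rule cancel) (use G_pos n4 in auto)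
  qed
  have "\<gamma> * V > 0" unfolding gamma_V using s_pos t_pos n4 by simp
  then have \<gamma>_pos: "\<gamma> > 0" using V_pos by (simp add: zero_less_mult_iff)
  have S_pos: "S > 0"
    using zero_less_mult_pos[of "real n * (real n + 2)" S] S V_pos n4 by simp
  have \<tau>_nonneg: "\<tau> \<ge> 0"
    unfolding \<tau> S_def[symmetric] t_def[symmetric] using t_pos \<gamma>_pos S_pos by simp
  have "\<tau> ^ 4 = t / (\<gamma> * S)"
    unfolding \<tau> S_def[symmetric] t_def[symmetric] using t_pos \<gamma>_pos S_pos
    by (intro real_root_pow_pos2) auto
  then have \<tau>4: "\<tau> ^ 4 * (\<gamma> * V) = t * real n * (real n + 2)"
    unfolding S[symmetric] using \<gamma>_pos S_pos by simp
  have AB: "A + B * real n / 2 = \<gamma> * V / (2 * (real n + 1))"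
    unfolding A B using n4 by (simp add: divide_simps) (simp add: power2_eq_square algebra_simps)
  have A0: "A + B * (real n)\<^sup>2 / (4 * (real n - 1)\<^sup>2) * (real n - 7) = 0"
    unfolding A B using n4 by (simp add: divide_simps) (simp add: power2_eq_square algebra_simps)
  have B4: "B * (real n + 1)\<^sup>2 / (2 * (real n - 1)\<^sup>2) = \<gamma> * V / (real n * (real n + 2))"
    unfolding B using n4 by (simp add: divide_simps)
  have \<tau>2: "\<tau>\<^sup>2 * (\<gamma> * V) / real n = s"
  \<comment> \<open>The radius is given through its fourth power, so the second moments are compared after squaring.\<close>
  proof (rule power2_eq_imp_eq)
    have "(\<tau>\<^sup>2 * (\<gamma> * V) / real n)\<^sup>2 = (\<tau> ^ 4 * (\<gamma> * V)) * (\<gamma> * V) / (real n)\<^sup>2"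
      by (simp add: power2_eq_square power4_eq_xxxx)
    also have "\<dots> = s\<^sup>2"
      unfolding \<tau>4 unfolding gamma_V using t_pos n4
      by (simp add: divide_simps) (simp add: power2_eq_square)
    finally show "(\<tau>\<^sup>2 * (\<gamma> * V) / real n)\<^sup>2 = s\<^sup>2" .
  qed (use \<open>\<gamma> * V > 0\<close> s_pos in auto)
  have C_eq: "C = simplex_rule e A B (1 - \<gamma> * V) \<tau>"
    unfolding C simplex_rule_def n(1) ..
  have cubature: "cubature_formula (n\<^sup>2 + 3 * n + 3) C" "A = 0 \<Longrightarrow> cubature_formula (n\<^sup>2 + n + 1) C"
    unfolding C_eq n(1) by (fact simplex_rule_cubature_formula simplex_rule_cubature_formula_A_0)+
  have degree: "cubature_of_degree L 5 N C" if "cubature_formula N C" for N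
  proof (rule eq_on_poly_funs_5I[OF that])
    show "C f = 0" if "\<And>x. f (- x) = - f x" for f
      unfolding C_eq using that by (rule simplex_rule_odd)
    show "C (\<lambda>x. 1) = 1"
      unfolding C_eq simplex_rule_one unfolding n(1)[symmetric] AB using n4 by simp
    have "2 * \<tau>\<^sup>2 * (\<gamma> * V / (2 * (real n + 1))) * (real n + 1) / real n = s"
      unfolding \<tau>2[symmetric] using n4 by (simp add: divide_simps)
    then show "C (\<lambda>x. x $ i * x $ j) = s * of_bool (i = j)" for i j
      unfolding C_eq
      using simplex_rule_second[OF e[unfolded n(1)] _, of A B "1 - \<gamma> * V" \<tau> i j] n(2)
      unfolding n(1)[symmetric] AB by simp
    have "\<tau> ^ 4 * B * (real n + 1)\<^sup>2 / (2 * (real n - 1)\<^sup>2)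
        = \<tau> ^ 4 * (B * (real n + 1)\<^sup>2 / (2 * (real n - 1)\<^sup>2))" by simp
    also have "\<dots> = \<tau> ^ 4 * (\<gamma> * V) / (real n * (real n + 2))" unfolding B4 by simp
    also have "\<dots> = t" unfolding \<tau>4 using n4 by simp
    finally show "C (\<lambda>x. x $ i * x $ j * x $ k * x $ l) =
      t * (of_bool (i = j \<and> k = l) + of_bool (i = k \<and> j = l) + of_bool (i = l \<and> j = k))" for i j k l
      unfolding C_eq
      using simplex_rule_fourth[OF e[unfolded n(1)] _ A0[unfolded n(1)], of "1 - \<gamma> * V" \<tau> i j k l] n(2)
      unfolding n(1)[symmetric] by simp
  qed
  show ?thesis
  proof (intro conjI impI)
    show "\<exists>N\<le>n\<^sup>2 + 3 * n + 3. cubature_of_degree L 5 N C"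
      using degree[OF cubature(1)] by blast
    assume "n = 7"
    then show "A = 0" unfolding A by simp
    then show "minimal_cubature_of_degree L 5 (n\<^sup>2 + n + 1) C"
      unfolding minimal_cubature_of_degree_def
      using degree[OF cubature(2)] lower_bound unfolding n(1)[symmetric] by blast
  qed
qed

end
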